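(* Let $X$ be an exact $2$-convex rearrangement invariant space of measurable functions on $(0,\infty)$ (with Lebesgue measure). Then \[ \left\| \frac{\sin \pi t}{\pi t}\right\|_X \le \left\| e^{-\pi t^2/2}\right\|_X , \] where both functions are regarded as functions of $t\in(0,\infty)$ and $\|h\|_X:=+\infty$ if $h\notin X$.
   Context: A rearrangement invariant (r.i.) space $X$ on $(0,\infty)$ is a Banach function lattice such that if $g^*\le f^*$ and $f\in X$ then $g\in X$ and $\|g\|_X\le\|f\|_X$, where $f^*(s)=\inf\{\tau>0:\ |\{|f|>\tau\}|\le s\}$ is the nonincreasing rearrangement. For $1\le p<\infty$, a Banach lattice $E$ is called exact $p$-convex if for all finite families $f_1,\dots,f_n\in E$, $\bigl\|(\sum_{k=1}^n|f_k|^p)^{1/p}\bigr\|_E\le(\sum_{k=1}^n\|f_k\|_E^p)^{1/p}$. *)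

theory Defs
  imports "HOL-Analysis.Analysis"
begin

text \<open>Functions on (0,infinity) are represented as functions real to real; only their
values on {0<..} matter.  A space X is represented by its (extended) norm functional
N :: (real \<Rightarrow> real) \<Rightarrow> ennreal, with the convention N h = \<infinity> iff h is not in X;
so X = {h. N h < \<infinity>}.\<close>

definition meas0 :: "(real \<Rightarrow> real) \<Rightarrow> bool" where
  "meas0 f \<longleftrightarrow> f \<in> borel_measurable (restrict_space lebesgue {0<..})"

text \<open>Nonincreasing rearrangement f*(s) = inf{tau>0 : |{x>0. |f x| > tau}| \<le> s}
(value \<infinity> if the set is empty).\<close>
definition rearr :: "(real \<Rightarrow> real) \<Rightarrow> real \<Rightarrow> ennreal" where
  "rearr f s = Inf {ennreal \<tau> | \<tau>. \<tau> > 0 \<and>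
      emeasure lebesgue {x \<in> {0<..}. \<tau> < \<bar>f x\<bar>} \<le> ennreal s}"

definition banach_function_lattice :: "((real \<Rightarrow> real) \<Rightarrow> ennreal) \<Rightarrow> bool" where
  "banach_function_lattice N \<longleftrightarrow>
     (\<forall>f. \<not> meas0 f \<longrightarrow> N f = \<infinity>) \<and>
     (\<forall>f. meas0 f \<longrightarrow> (N f = 0 \<longleftrightarrow> (AE x in lebesgue. x > 0 \<longrightarrow> f x = 0))) \<and>
     (\<forall>f c. meas0 f \<longrightarrow> N (\<lambda>x. c * f x) = ennreal \<bar>c\<bar> * N f) \<and>
     (\<forall>f g. N (\<lambda>x. f x + g x) \<le> N f + N g) \<and>
     (\<forall>f g. meas0 f \<longrightarrow> meas0 g \<longrightarrow> (AE x in lebesgue. x > 0 \<longrightarrow> \<bar>g x\<bar> \<le> \<bar>f x\<bar>)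
            \<longrightarrow> N g \<le> N f) \<and>
     (\<forall>F :: nat \<Rightarrow> real \<Rightarrow> real.
        (\<forall>n. N (F n) < \<infinity>) \<and>
        (\<forall>e::real. e > 0 \<longrightarrow> (\<exists>M. \<forall>m\<ge>M. \<forall>n\<ge>M. N (\<lambda>x. F m x - F n x) < ennreal e))
        \<longrightarrow> (\<exists>f. N f < \<infinity> \<and> (\<lambda>n. N (\<lambda>x. F n x - f x)) \<longlonglongrightarrow> 0))"

text \<open>Rearrangement invariant space: if g* \<le> f* and f \<in> X then g \<in> X and the norm of g
is at most the norm of f (with N = \<infinity> outside X this is just N g \<le> N f).\<close>
definition ri_space :: "((real \<Rightarrow> real) \<Rightarrow> ennreal) \<Rightarrow> bool" where
  "ri_space N \<longleftrightarrow> banach_function_lattice N \<and>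
     (\<forall>f g. meas0 f \<longrightarrow> meas0 g \<longrightarrow> N f < \<infinity> \<longrightarrow> (\<forall>s>0. rearr g s \<le> rearr f s)
            \<longrightarrow> N g \<le> N f)"

definition exact_p_convex :: "real \<Rightarrow> ((real \<Rightarrow> real) \<Rightarrow> ennreal) \<Rightarrow> bool" where
  "exact_p_convex p N \<longleftrightarrow>
     (\<forall>(F :: nat \<Rightarrow> real \<Rightarrow> real) n. (\<forall>k<n. N (F k) < \<infinity>) \<longrightarrow>
        N (\<lambda>x. (\<Sum>k<n. \<bar>F k x\<bar> powr p) powr (1/p))
          \<le> ennreal ((\<Sum>k<n. enn2real (N (F k)) powr p) powr (1/p)))"

end

theory Submission
  imports Defs "HOL-Combinatorics.Permutations" "HOL-Probability.Sinc_Integral" "HOL-Real_Asymp.Real_Asymp"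
begin

text \<open>
Put \<open>u t = (sin (\<pi>t) / (\<pi>t))\<^sup>2\<close>, \<open>v t = exp (- \<pi>t\<^sup>2)\<close> and \<open>M h = N (sqrt h)\<^sup>2\<close>. By exact 2-convexity
\<open>M\<close> is a rearrangement invariant subadditive functional, which for the present functions reduces the claim to showing that \<open>u\<close> is submajorized
by \<open>v\<close>, i.e. \<open>\<integral>(u - c)\<^sub>+ \<le> \<integral>(v - c)\<^sub>+\<close> for all \<open>c > 0\<close>.

For \<open>c \<ge> 1/16\<close> this holds pointwise: the product formula for the sine gives \<open>u \<le> v\<close> on \<open>(0, 1]\<close>, and
\<open>u \<le> 1/16\<close> beyond. For \<open>c < 1/16\<close> both \<open>u\<close> and \<open>v\<close> have integral \<open>1/2\<close>, and with \<open>A = 1 / (\<pi> sqrt c)\<close>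
and \<open>v s = c\<close> one finds \<open>\<integral>min u c \<ge> c (A - 1/(4\<pi>)) \<ge> c (s + 1/(2\<pi>s)) \<ge> \<integral>min v c\<close>.

A rearrangement invariant norm need not respect submajorization in general. Here \<open>u\<close> and \<open>v\<close> are
continuous and \<open>O(t\<^sup>-\<^sup>2)\<close>, so up to errors small in \<open>M\<close> they are step functions with finitely many steps
of equal length, and for these the Hardy--Littlewood--Polya transfers between two steps, each an
average of a function and a rearrangement of it, give the inequality.
\<close>

section \<open>Majorization of finite sequences and step functions\<close>

text \<open>Induction on the number of indices where \<open>a\<close> and \<open>b\<close> differ:
  each transfer from a surplus entry of \<open>b\<close> to its first deficient entry repairs at
  least one of them. Totals need not agree; once \<open>a\<close> lies below \<open>b\<close>,
  monotonicity takes up the slack.\<close>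

lemma transfer_majorization:
  fixes \<phi> :: "(nat \<Rightarrow> real) \<Rightarrow> 'b::preorder" and a b :: "nat \<Rightarrow> real"
  assumes mono: "\<And>a b. (\<And>k. k < n \<Longrightarrow> 0 \<le> a k \<and> a k \<le> b k) \<Longrightarrow> \<phi> a \<le> \<phi> b"
    and transfer: "\<And>b i j t. \<lbrakk>i < n; j < n; i \<noteq> j; \<And>k. k < n \<Longrightarrow> 0 \<le> b k; 0 \<le> t; t \<le> b i - b j\<rbrakk>
      \<Longrightarrow> \<phi> (b(i := b i - t, j := b j + t)) \<le> \<phi> b"
    and a: "\<And>i j. i \<le> j \<Longrightarrow> j < n \<Longrightarrow> a j \<le> a i" "\<And>k. k < n \<Longrightarrow> 0 \<le> a k"
    and b: "\<And>k. k < n \<Longrightarrow> 0 \<le> b k"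
    and prefix: "\<And>l. l \<le> n \<Longrightarrow> (\<Sum>k<l. a k) \<le> (\<Sum>k<l. b k)"
  shows "\<phi> a \<le> \<phi> b"
  using b prefix
proof (induction "card {k. k < n \<and> a k \<noteq> b k}" arbitrary: b rule: less_induct)
  case less
  show ?case
  proof (cases "\<forall>k<n. a k \<le> b k")
    case True
    then show ?thesis using a by (intro mono) auto
  next
    case False
    define j where "j = (LEAST k. k < n \<and> b k < a k)"
    have j: "j < n" "b j < a j" and jmin: "\<And>k. k < j \<Longrightarrow> a k \<le> b k"
    proof -
      have ex: "\<exists>k. k < n \<and> b k < a k" using False by (auto simp: not_le)
      show *: "j < n" "b j < a j" using LeastI_ex[OF ex] by (auto simp: j_def)
      fix k assume "k < j"
      then show "a k \<le> b k" using not_less_Least[of k "\<lambda>k. k < n \<and> b k < a k"] * by (auto simp: j_def)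
    qed
    have "\<exists>i<j. a i < b i"
    proof (rule ccontr)
      assume "\<not> ?thesis"
      then have "(\<Sum>k<j. b k) \<le> (\<Sum>k<j. a k)" by (intro sum_mono) (meson lessThan_iff not_less)
      moreover have "(\<Sum>k<Suc j. a k) \<le> (\<Sum>k<Suc j. b k)" using less.prems(2)[of "Suc j"] j by simp
      ultimately show False using j by simp
    qed
    then obtain i where i: "i < j" "a i < b i" by blast
    \<comment> \<open>The largest amount that leaves \<open>b i\<close> above \<open>a i\<close> and
      \<open>b j\<close> below \<open>a j\<close>; one of the two becomes an equality, so the number
      of disagreements drops.\<close>
    define t where "t = min (b i - a i) (a j - b j)"
    define b' where "b' = b(i := b i - t, j := b j + t)"
    have t: "0 < t" "t \<le> b i - a i" "t \<le> a j - b j" using i j by (auto simp: t_def)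
    have aij: "a j \<le> a i" using a(1)[of i j] i j by simp
    have "\<phi> a \<le> \<phi> b'"
    proof (rule less.hyps)
      have "t = b i - a i \<or> t = a j - b j" by (auto simp: t_def)
      then obtain k where k: "k \<in> {i, j}" "a k = b' k" using i unfolding b'_def by fastforce
      then have "k < n" "a k \<noteq> b k" using i j by auto
      moreover have "a k \<noteq> b k" if "a k \<noteq> b' k" for k using that i j by (cases "k = i \<or> k = j") (auto simp: b'_def)
      ultimately have "{k. k < n \<and> a k \<noteq> b' k} \<subset> {k. k < n \<and> a k \<noteq> b k}"
        using k(2) by blast
      then show "card {k. k < n \<and> a k \<noteq> b' k} < card {k. k < n \<and> a k \<noteq> b k}"
        by (intro psubset_card_mono) auto
    next
      fix k assume "k < n"
      then show "0 \<le> b' k" using less.prems(1)[of k] t a(2)[of i] i j aij by (auto simp: b'_def)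
    next
      fix l assume l: "l \<le> n"
      have b'eq: "b' k = b k - (if k = i then t else 0) + (if k = j then t else 0)" for k
        using i by (auto simp: b'_def)
      have sum': "(\<Sum>k<l. b' k) = (\<Sum>k<l. b k) - (if i < l then t else 0) + (if j < l then t else 0)"
        by (simp add: b'eq sum.distrib sum_subtractf)
      \<comment> \<open>Only prefixes containing i but not j lose t. They end before the first
        deficient entry, so \<open>a\<close> is below \<open>b\<close> throughout, and the surplus
        at i alone covers t.\<close>
      show "(\<Sum>k<l. a k) \<le> (\<Sum>k<l. b' k)"
      proof (cases "i < l \<and> l \<le> j")
        case True
        have "(\<Sum>k<l. a k) + t = (\<Sum>k<l. a k + (if k = i then t else 0))"
          using True by (simp add: sum.distrib)
        also have "\<dots> \<le> (\<Sum>k<l. b k)"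
          using True t jmin by (intro sum_mono) auto
        finally show ?thesis using True by (simp add: sum')
      next
        case False
        then show ?thesis using less.prems(2)[OF l] t i by (auto simp: sum')
      qed
    qed
    also have "\<phi> b' \<le> \<phi> b"
      unfolding b'_def using i j t aij less.prems(1) by (intro transfer) auto
    finally show ?thesis .
  qed
qed

lemma exists_antitone_permutation:
  fixes a :: "nat \<Rightarrow> 'a::linorder"
  obtains p where "p permutes {..<n}" "\<And>i j. i \<le> j \<Longrightarrow> j < n \<Longrightarrow> a (p j) \<le> a (p i)"
proof -
  define ys where "ys = map a [0..<n]"
  define xs where "xs = rev (sort ys)"
  have "mset xs = mset ys" by (simp add: xs_def)
  then obtain p where p: "p permutes {..<length ys}" "permute_list p ys = xs"
    by (rule mset_eq_permutation)
  have len: "length ys = n" "length xs = n" by (auto simp: ys_def xs_def)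
  have xs_nth: "xs ! k = a (p k)" if "k < n" for k
  proof -
    have "p k < n" using p(1) that permutes_in_image[OF p(1), of k] by (simp add: len)
    then show ?thesis using permute_list_nth[of p ys k] p that by (simp add: len ys_def)
  qed
  have "a (p j) \<le> a (p i)" if "i \<le> j" "j < n" for i j
    using sorted_rev_nth_mono[of xs i j] that xs_nth[of i] xs_nth[of j]
    by (simp add: xs_def len ys_def)
  with p(1) show thesis by (intro that[of p]) (auto simp: len)
qed

text \<open>At the level of the l-th entry of \<open>b\<close>, the first l entries of the antitone
  \<open>b\<close> carry all its excess, while any l entries of \<open>a\<close> sum to at most l
  times the level plus the excess of \<open>a\<close>. Positivity of \<open>b\<close> makes this
  level admissible in \<open>excess\<close>.\<close>

lemma prefix_sum_le_of_excess_le: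
  fixes a b :: "nat \<Rightarrow> real"
  assumes b: "\<And>i j. i \<le> j \<Longrightarrow> j < n \<Longrightarrow> b j \<le> b i" "\<And>k. k < n \<Longrightarrow> 0 < b k"
    and excess: "\<And>c. 0 < c \<Longrightarrow> (\<Sum>k<n. max 0 (a k - c)) \<le> (\<Sum>k<n. max 0 (b k - c))"
    and l: "l \<le> n"
  shows "(\<Sum>k<l. a k) \<le> (\<Sum>k<l. b k)"
proof (cases l)
  case (Suc m)
  define c where "c = b m"
  have c: "0 < c" using b(2) l Suc by (simp add: c_def)
  have "(\<Sum>k<l. a k) \<le> (\<Sum>k<l. c + max 0 (a k - c))" by (intro sum_mono) auto
  also have "\<dots> \<le> real l * c + (\<Sum>k<n. max 0 (a k - c))"
    using l by (simp add: sum.distrib sum_mono2)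
  also have "\<dots> \<le> real l * c + (\<Sum>k<n. max 0 (b k - c))" using excess[OF c] by simp
  also have "(\<Sum>k<n. max 0 (b k - c)) = (\<Sum>k<l. b k - c)"
  proof (rule sum.mono_neutral_cong_right)
    have "b k \<le> c" if "k \<in> {..<n} - {..<l}" for k
      using b(1)[of m k] Suc that by (simp add: c_def)
    then show "\<forall>k\<in>{..<n} - {..<l}. max 0 (b k - c) = 0" by (meson diff_le_0_iff_le max_absorb1)
    show "max 0 (b k - c) = b k - c" if "k \<in> {..<l}" for k
      using b(1)[of k m] Suc that l by (auto simp: c_def)
  qed (use l in auto)
  finally show ?thesis by (simp add: sum_subtractf)
qed simp

section \<open>Step functions on cells of equal length\<close>

definition cell :: "real \<Rightarrow> nat \<Rightarrow> real set" where
  "cell d k = {d * real k<..d * real (Suc k)}"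

definition step :: "real \<Rightarrow> nat \<Rightarrow> (nat \<Rightarrow> real) \<Rightarrow> real \<Rightarrow> real" where
  "step d n a x = (\<Sum>k<n. a k * indicator (cell d k) x)"

lemma cell_measurable [measurable]: "cell d k \<in> sets borel"
  by (simp add: cell_def)

lemma step_measurable [measurable]: "step d n a \<in> borel_measurable borel"
  unfolding step_def[abs_def] by measurable

lemma cell_unique:
  assumes "0 < d" "x \<in> cell d j" "x \<in> cell d k"
  shows "j = k"
proof -
  have "d * real j < d * real (Suc k)" "d * real k < d * real (Suc j)"
    using assms(2,3) unfolding cell_def greaterThanAtMost_iff by linarith+
  then have "j < Suc k" "k < Suc j" using assms(1) by (simp_all only: mult_less_cancel_left_pos of_nat_less_iff)
  then show ?thesis by simp
qed

lemma cell_exists: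
  assumes "0 < d" "0 < x" "x \<le> d * real n"
  obtains k where "k < n" "x \<in> cell d k"
proof -
  have "\<exists>k<n. x \<in> cell d k" using assms(3)
  proof (induction n)
    case 0
    then show ?case using assms by simp
  next
    case (Suc n)
    show ?case
    proof (cases "x \<le> d * real n")
      case True
      then show ?thesis using Suc by (auto intro: less_SucI)
    next
      case False
      then have "x \<in> cell d n" using Suc by (auto simp: cell_def)
      then show ?thesis by blast
    qed
  qed
  then show thesis using that by blast
qed

lemma step_in_cell:
  assumes "0 < d" "x \<in> cell d k" "k < n"
  shows "step d n a x = a k"
proof -
  have "(indicator (cell d j) x :: real) = of_bool (j = k)" for j
    using assms(2) cell_unique[OF assms(1) _ assms(2)] by (metis indicator_simps of_bool_eq)
  then have "step d n a x = (\<Sum>j<n. if j = k then a j else 0)"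
    unfolding step_def by (intro sum.cong) auto
  also have "\<dots> = a k" using assms(3) by simp
  finally show ?thesis .
qed

lemma step_outside: "(\<And>k. k < n \<Longrightarrow> x \<notin> cell d k) \<Longrightarrow> step d n a x = 0"
  by (auto simp: step_def)

lemma step_nonneg: "(\<And>k. k < n \<Longrightarrow> 0 \<le> a k) \<Longrightarrow> 0 \<le> step d n a x"
  by (auto simp: step_def intro!: sum_nonneg)

lemma step_mono: "(\<And>k. k < n \<Longrightarrow> a k \<le> b k) \<Longrightarrow> step d n a x \<le> step d n b x"
  by (auto simp: step_def indicator_def intro!: sum_mono)

lemma cell_pos: "0 < d \<Longrightarrow> x \<in> cell d k \<Longrightarrow> 0 < x"
  using le_less_trans[of 0 "d * real k" x] by (simp add: cell_def)

lemma step_levelset: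
  assumes "0 < d" "0 \<le> \<tau>"
  shows "{x \<in> {0<..}. \<tau> < step d n a x} = (\<Union>k\<in>{k. k < n \<and> \<tau> < a k}. cell d k)"
proof (intro set_eqI iffI)
  fix x assume x: "x \<in> {x \<in> {0<..}. \<tau> < step d n a x}"
  then obtain k where "k < n" "x \<in> cell d k" using step_outside[of n x d a] assms by force
  then show "x \<in> (\<Union>k\<in>{k. k < n \<and> \<tau> < a k}. cell d k)" using x step_in_cell[OF assms(1), of x k n a] by auto
next
  fix x assume "x \<in> (\<Union>k\<in>{k. k < n \<and> \<tau> < a k}. cell d k)"
  then show "x \<in> {x \<in> {0<..}. \<tau> < step d n a x}" using step_in_cell[OF assms(1)] cell_pos[OF assms(1)] by auto
qed

lemma emeasure_step_levelset:
  assumes "0 < d" "0 \<le> \<tau>"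
  shows "emeasure lebesgue {x \<in> {0<..}. \<tau> < step d n a x} = of_nat (card {k. k < n \<and> \<tau> < a k}) * ennreal d"
proof -
  have "emeasure lebesgue (\<Union>k\<in>{k. k < n \<and> \<tau> < a k}. cell d k)
      = (\<Sum>k\<in>{k. k < n \<and> \<tau> < a k}. emeasure lebesgue (cell d k))"
    using cell_unique[OF assms(1)]
    by (intro sum_emeasure[symmetric]) (auto simp: disjoint_family_on_def image_subset_iff)
  also have "\<dots> = (\<Sum>k\<in>{k. k < n \<and> \<tau> < a k}. ennreal d)"
    using assms by (intro sum.cong) (auto simp: cell_def algebra_simps)
  finally show ?thesis unfolding step_levelset[OF assms] by simp
qed

section \<open>Measurability and distribution functions\<close>

lemma meas0_borel: "f \<in> borel_measurable borel \<Longrightarrow> meas0 f"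
  unfolding meas0_def by (intro measurable_restrict_space1 measurable_completion) simp

lemma meas0_sqrt: "meas0 f \<Longrightarrow> meas0 (\<lambda>x. sqrt (f x))"
  unfolding meas0_def by measurable

lemma meas0_diff: "meas0 f \<Longrightarrow> meas0 g \<Longrightarrow> meas0 (\<lambda>x. f x - g x)"
  unfolding meas0_def by measurable

lemma rearr_mono:
  assumes "\<And>\<tau>. 0 < \<tau> \<Longrightarrow> emeasure lebesgue {x \<in> {0<..}. \<tau> < \<bar>g x\<bar>}
    \<le> emeasure lebesgue {x \<in> {0<..}. \<tau> < \<bar>f x\<bar>}"
  shows "rearr g s \<le> rearr f s"
  unfolding rearr_def
proof (rule Inf_superset_mono, clarify)
  fix \<tau> :: real
  assume "0 < \<tau>" "emeasure lebesgue {x \<in> {0<..}. \<tau> < \<bar>f x\<bar>} \<le> ennreal s"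
  then show "\<exists>\<tau>'. ennreal \<tau> = ennreal \<tau>' \<and> 0 < \<tau>' \<and> emeasure lebesgue {x \<in> {0<..}. \<tau>' < \<bar>g x\<bar>} \<le> ennreal s"
    using assms[of \<tau>] by (intro exI[of _ \<tau>]) auto
qed

lemma ennreal_power2_le_iff: "a\<^sup>2 \<le> b\<^sup>2 \<longleftrightarrow> a \<le> (b::ennreal)"
proof
  assume "a \<le> b"
  then show "a\<^sup>2 \<le> b\<^sup>2" by (intro power_mono) auto
next
  assume *: "a\<^sup>2 \<le> b\<^sup>2"
  show "a \<le> b"
    using * by (cases a; cases b) (auto simp: ennreal_power top_unique dest: power2_le_imp_le)
qed

lemma meas0_sum: "(\<And>k. k \<in> I \<Longrightarrow> meas0 (f k)) \<Longrightarrow> meas0 (\<lambda>x. \<Sum>k\<in>I. f k x)"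
  unfolding meas0_def by (rule borel_measurable_sum)

section \<open>Integrals over cells and beyond a cutoff\<close>

lemma integral_cells:
  fixes f :: "real \<Rightarrow> real"
  assumes "continuous_on UNIV f" "0 \<le> d"
  shows "integral {0..d * real n} f = (\<Sum>k<n. integral {d * real k..d * real (Suc k)} f)"
proof (induction n)
  case (Suc n)
  have "integral {0..d * real n} f + integral {d * real n..d * real (Suc n)} f = integral {0..d * real (Suc n)} f"
    using assms
    by (intro Henstock_Kurzweil_Integration.integral_combine integrable_continuous_interval)
       (auto intro: continuous_on_subset mult_left_mono)
  then show ?case using Suc by simp
qed simp

lemma
  fixes f :: "real \<Rightarrow> real"
  assumes "continuous_on UNIV f" "0 \<le> d"
  shows integral_cell_le: "(\<And>t. t \<in> {d * real k..d * real (Suc k)} \<Longrightarrow> f t \<le> B)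
      \<Longrightarrow> integral {d * real k..d * real (Suc k)} f \<le> d * B"
    and integral_cell_ge: "(\<And>t. t \<in> {d * real k..d * real (Suc k)} \<Longrightarrow> B \<le> f t)
      \<Longrightarrow> d * B \<le> integral {d * real k..d * real (Suc k)} f"
proof -
  have int: "f integrable_on {d * real k..d * real (Suc k)}"
    using assms by (intro integrable_continuous_interval) (auto intro: continuous_on_subset)
  have const: "integral {d * real k..d * real (Suc k)} (\<lambda>_. B) = d * B"
    using assms by (simp add: algebra_simps)
  show "integral {d * real k..d * real (Suc k)} f \<le> d * B"
    if "\<And>t. t \<in> {d * real k..d * real (Suc k)} \<Longrightarrow> f t \<le> B"
    unfolding const[symmetric] using that by (intro integral_le int) auto
  show "d * B \<le> integral {d * real k..d * real (Suc k)} f"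
    if "\<And>t. t \<in> {d * real k..d * real (Suc k)} \<Longrightarrow> B \<le> f t"
    unfolding const[symmetric] using that by (intro integral_le int) auto
qed

text \<open>The excess beyond T is at most the integral of \<open>C / t^2\<close> over the half-line
  from T, and it vanishes when \<open>v T\<close> is already below the level c. The case distinction
  is kept in the bound because the later compensation works exactly at levels below
  \<open>v T\<close>.\<close>

lemma integral_excess_tail_le:
  fixes v :: "real \<Rightarrow> real"
  assumes v: "continuous_on UNIV v" "\<And>t. 0 < t \<Longrightarrow> v t \<le> C / t\<^sup>2"
      "\<And>s t. 0 \<le> s \<Longrightarrow> s \<le> t \<Longrightarrow> v t \<le> v s"
    and C: "0 \<le> C" and T: "0 < T" "0 \<le> S" and c: "0 < c"
  shows "integral {0..S} (\<lambda>t. max 0 (v t - c))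
    \<le> integral {0..T} (\<lambda>t. max 0 (v t - c)) + (if c < v T then C / T else 0)"
proof -
  define w where "w t = max 0 (v t - c)" for t
  have cont: "continuous_on A w" for A
    unfolding w_def using v(1) by (intro continuous_intros) (auto intro: continuous_on_subset)
  have int: "w integrable_on {x..y}" for x y by (intro integrable_continuous_interval cont)
  have nonneg: "0 \<le> (if c < v T then C / T else 0)" using C T by simp
  have "integral {0..S} w \<le> integral {0..T} w + (if c < v T then C / T else 0)"
  proof (cases "S \<le> T")
    case True
    have "integral {0..S} w \<le> integral {0..T} w"
      using True T by (intro integral_subset_le int) (auto simp: w_def)
    then show ?thesis using nonneg by linarith
  next
    case False
    then have TS: "T \<le> S" by simp
    have "((\<lambda>t. C / t\<^sup>2) has_integral (- C / S - - C / T)) {T..S}"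
      using TS T
      by (intro fundamental_theorem_of_calculus)
         (auto intro!: derivative_eq_intros simp: power2_eq_square has_real_derivative_iff_has_vector_derivative[symmetric])
    then have *: "(\<lambda>t. C / t\<^sup>2) integrable_on {T..S}" "integral {T..S} (\<lambda>t. C / t\<^sup>2) = C / T - C / S"
      by (auto simp: integrable_on_def integral_unique)
    have "integral {T..S} w \<le> (if c < v T then C / T else 0)"
    proof (cases "c < v T")
      case True
      have "w t \<le> C / t\<^sup>2" if "t \<in> {T..S}" for t
        using v(2)[of t] that c T C by (auto simp: w_def)
      then have "integral {T..S} w \<le> integral {T..S} (\<lambda>t. C / t\<^sup>2)"
        by (intro integral_le int *)
      also have "\<dots> \<le> C / T" using C T TS by (simp add: *)
      finally show ?thesis using True by simp
    next
      case False
      have "w t = 0" if "t \<in> {T..S}" for t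
        using v(3)[of T t] that False T by (auto simp: w_def)
      then have "integral {T..S} w = integral {T..S} (\<lambda>_. 0)" by (intro integral_cong)
      then show ?thesis using False by simp
    qed
    moreover have "integral {0..T} w + integral {T..S} w = integral {0..S} w"
      using TS T by (intro Henstock_Kurzweil_Integration.integral_combine int) auto
    ultimately show ?thesis by linarith
  qed
  then show ?thesis by (simp add: w_def[abs_def])
qed

section \<open>Submajorization in exact 2-convex rearrangement invariant spaces\<close>

locale two_convex_ri_space =
  fixes N :: "(real \<Rightarrow> real) \<Rightarrow> ennreal"
  assumes ri: "ri_space N" and two_convex: "exact_p_convex 2 N"
begin

text \<open>Two-convexity of \<open>N\<close> says precisely that \<open>M\<close>, the norm of the 2-concavification, is subadditive.\<close>
definition M :: "(real \<Rightarrow> real) \<Rightarrow> ennreal" where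
  "M h = (N (\<lambda>x. sqrt (h x)))\<^sup>2"

section \<open>Lattice norm, completeness and rearrangement invariance\<close>

lemma meas0_of_finite: "N f < \<infinity> \<Longrightarrow> meas0 f"
  using ri by (auto simp: ri_space_def banach_function_lattice_def)

lemma N_eq_0_iff: "meas0 f \<Longrightarrow> N f = 0 \<longleftrightarrow> (AE x in lebesgue. x > 0 \<longrightarrow> f x = 0)"
  using ri by (simp add: ri_space_def banach_function_lattice_def)

lemma N_scale: "meas0 f \<Longrightarrow> N (\<lambda>x. c * f x) = ennreal \<bar>c\<bar> * N f"
  using ri by (simp add: ri_space_def banach_function_lattice_def)

lemma N_add_le: "N (\<lambda>x. f x + g x) \<le> N f + N g"
  using ri by (simp add: ri_space_def banach_function_lattice_def)

lemma N_mono_AE: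
  "meas0 f \<Longrightarrow> meas0 g \<Longrightarrow> (AE x in lebesgue. x > 0 \<longrightarrow> \<bar>g x\<bar> \<le> \<bar>f x\<bar>) \<Longrightarrow> N g \<le> N f"
  using ri by (simp add: ri_space_def banach_function_lattice_def)

lemma N_mono:
  "meas0 f \<Longrightarrow> meas0 g \<Longrightarrow> (\<And>x. x > 0 \<Longrightarrow> \<bar>g x\<bar> \<le> \<bar>f x\<bar>) \<Longrightarrow> N g \<le> N f"
  by (rule N_mono_AE) auto

lemma N_complete:
  assumes "\<And>n. N (F n) < \<infinity>"
    and "\<And>e::real. e > 0 \<Longrightarrow> \<exists>K. \<forall>m\<ge>K. \<forall>n\<ge>K. N (\<lambda>x. F m x - F n x) < ennreal e"
  obtains f where "N f < \<infinity>" "(\<lambda>n. N (\<lambda>x. F n x - f x)) \<longlonglongrightarrow> 0"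
proof -
  have "\<exists>f. N f < \<infinity> \<and> (\<lambda>n. N (\<lambda>x. F n x - f x)) \<longlonglongrightarrow> 0"
    using ri[unfolded ri_space_def banach_function_lattice_def, THEN conjunct1, THEN conjunct2,
        THEN conjunct2, THEN conjunct2, THEN conjunct2, THEN conjunct2, rule_format, of F] assms
    by auto
  then show thesis using that by blast
qed

text \<open>Rearrangement invariance enters in this form: ordered distribution functions give
  ordered rearrangements. If \<open>N f\<close> is infinite the bound is trivial.\<close>

lemma N_le_of_levelset_le:
  assumes "meas0 f" "meas0 g"
    and "\<And>\<tau>. 0 < \<tau> \<Longrightarrow> emeasure lebesgue {x \<in> {0<..}. \<tau> < \<bar>g x\<bar>}
      \<le> emeasure lebesgue {x \<in> {0<..}. \<tau> < \<bar>f x\<bar>}"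
  shows "N g \<le> N f"
proof (cases "N f < \<infinity>")
  case True
  then show ?thesis using ri assms rearr_mono[of g f] by (auto simp: ri_space_def)
qed (simp add: not_less top_unique)

section \<open>Monotonicity, homogeneity and subadditivity of \<open>M\<close>\<close>

lemma M_mono:
  assumes "meas0 g" "meas0 h" "\<And>x. 0 < x \<Longrightarrow> 0 \<le> g x \<and> g x \<le> h x"
  shows "M g \<le> M h"
  unfolding M_def ennreal_power2_le_iff
proof (rule N_mono)
  show "\<bar>sqrt (g x)\<bar> \<le> \<bar>sqrt (h x)\<bar>" if "0 < x" for x
    using assms(3)[OF that] by simp
qed (use assms in \<open>auto intro: meas0_sqrt\<close>)

lemma M_scale:
  assumes "meas0 h" "0 \<le> c"
  shows "M (\<lambda>x. c * h x) = ennreal c * M h"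
proof -
  have "M (\<lambda>x. c * h x) = (ennreal (sqrt c) * N (\<lambda>x. sqrt (h x)))\<^sup>2"
    using assms by (simp add: M_def real_sqrt_mult N_scale[OF meas0_sqrt])
  also have "\<dots> = ennreal c * M h"
    using assms by (simp add: M_def power_mult_distrib ennreal_power)
  finally show ?thesis .
qed

text \<open>Exact 2-convexity for the functions \<open>sqrt (h k)\<close>, squared. It speaks of
  finite norms only, but a summand with infinite \<open>M\<close> makes the right-hand side
  infinite.\<close>

lemma M_sum_le:
  fixes n :: nat
  assumes "\<And>k x. k < n \<Longrightarrow> 0 \<le> h k x"
  shows "M (\<lambda>x. \<Sum>k<n. h k x) \<le> (\<Sum>k<n. M (h k))"
proof (cases "\<forall>k<n. N (\<lambda>x. sqrt (h k x)) < \<infinity>")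
  case True
  define F where "F k x = sqrt (h k x)" for k x
  have fin: "\<forall>k<n. N (F k) < \<infinity>" using True by (simp add: F_def[abs_def])
  have "N (\<lambda>x. (\<Sum>k<n. \<bar>F k x\<bar> powr 2) powr (1/2))
      \<le> ennreal ((\<Sum>k<n. enn2real (N (F k)) powr 2) powr (1/2))"
    using two_convex[unfolded exact_p_convex_def, rule_format, of n F] fin by simp
  also have "(\<lambda>x. (\<Sum>k<n. \<bar>F k x\<bar> powr 2) powr (1/2)) = (\<lambda>x. sqrt (\<Sum>k<n. h k x))"
  proof (rule ext)
    fix x
    have "(\<Sum>k<n. \<bar>F k x\<bar> powr 2) = (\<Sum>k<n. h k x)" using assms by (auto simp: F_def intro!: sum.cong)
    moreover have "0 \<le> (\<Sum>k<n. h k x)" using assms by (auto intro!: sum_nonneg)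
    ultimately show "(\<Sum>k<n. \<bar>F k x\<bar> powr 2) powr (1/2) = sqrt (\<Sum>k<n. h k x)"
      by (simp add: powr_half_sqrt)
  qed
  also have "(\<Sum>k<n. enn2real (N (F k)) powr 2) powr (1/2) = sqrt (\<Sum>k<n. (enn2real (N (F k)))\<^sup>2)"
    by (simp add: powr_half_sqrt sum_nonneg)
  finally have "M (\<lambda>x. \<Sum>k<n. h k x) \<le> (ennreal (sqrt (\<Sum>k<n. (enn2real (N (F k)))\<^sup>2)))\<^sup>2"
    by (simp add: M_def power_mono)
  also have "\<dots> = ennreal (\<Sum>k<n. (enn2real (N (F k)))\<^sup>2)"
    by (simp add: ennreal_power sum_nonneg)
  also have "\<dots> = (\<Sum>k<n. M (h k))"
    using fin by (auto simp: M_def F_def[abs_def] simp flip: sum_ennreal ennreal_power intro!: sum.cong)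
  finally show ?thesis .
next
  case False
  then obtain k where k: "k < n" "M (h k) = \<infinity>" by (auto simp: M_def not_less top_unique)
  then have "(\<Sum>k<n. M (h k)) = \<infinity>" by auto
  then show ?thesis by (simp only: infinity_ennreal_def top_greatest)
qed

lemma M_add_le:
  assumes "\<And>x. 0 \<le> g x" "\<And>x. 0 \<le> h x"
  shows "M (\<lambda>x. g x + h x) \<le> M g + M h"
proof -
  have "{..<2::nat} = {0, 1}" by auto
  then show ?thesis using M_sum_le[of 2 "\<lambda>k. if k = 0 then g else h"] assms by simp
qed

lemma M_le_of_levelset_le:
  assumes "meas0 g" "meas0 h" "\<And>x. 0 \<le> g x" "\<And>x. 0 \<le> h x"
    and le: "\<And>\<tau>. 0 < \<tau> \<Longrightarrow> emeasure lebesgue {x \<in> {0<..}. \<tau> < g x}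
      \<le> emeasure lebesgue {x \<in> {0<..}. \<tau> < h x}"
  shows "M g \<le> M h"
  unfolding M_def ennreal_power2_le_iff
proof (rule N_le_of_levelset_le)
  fix \<tau> :: real assume "0 < \<tau>"
  then have "\<tau> < \<bar>sqrt (f x)\<bar> \<longleftrightarrow> \<tau>\<^sup>2 < f x" if "0 \<le> f x" for f :: "real \<Rightarrow> real" and x
    using that real_less_rsqrt[of \<tau> "f x"] real_sqrt_less_iff[of "\<tau>\<^sup>2" "f x"] by auto
  then show "emeasure lebesgue {x \<in> {0<..}. \<tau> < \<bar>sqrt (g x)\<bar>}
      \<le> emeasure lebesgue {x \<in> {0<..}. \<tau> < \<bar>sqrt (h x)\<bar>}"
    using le[of "\<tau>\<^sup>2"] assms \<open>0 < \<tau>\<close> by simp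
qed (use assms(1,2) in \<open>auto intro: meas0_sqrt\<close>)

section \<open>\<open>M\<close> on step functions\<close>

lemma M_step_le_of_card_le:
  assumes "0 < d" "\<And>k. k < n \<Longrightarrow> 0 \<le> a k" "\<And>k. k < m \<Longrightarrow> 0 \<le> b k"
    and "\<And>\<tau>. 0 < \<tau> \<Longrightarrow> card {k. k < n \<and> \<tau> < a k} \<le> card {k. k < m \<and> \<tau> < b k}"
  shows "M (step d n a) \<le> M (step d m b)"
proof (rule M_le_of_levelset_le)
  fix \<tau> :: real assume "0 < \<tau>"
  then show "emeasure lebesgue {x \<in> {0<..}. \<tau> < step d n a x}
      \<le> emeasure lebesgue {x \<in> {0<..}. \<tau> < step d m b x}"
    using assms(1) assms(4)[of \<tau>]
    unfolding emeasure_step_levelset[OF assms(1) less_imp_le[OF \<open>0 < \<tau>\<close>]]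
    by (intro mult_right_mono of_nat_mono) auto
qed (use assms(2,3) in \<open>auto intro!: meas0_borel step_nonneg\<close>)

lemma M_step_permute:
  assumes "0 < d" "p permutes {..<n}" "\<And>k. k < n \<Longrightarrow> 0 \<le> a k"
  shows "M (step d n (a \<circ> p)) = M (step d n a)"
proof -
  have lt: "p k < n \<longleftrightarrow> k < n" for k using permutes_in_image[OF assms(2), of k] by simp
  have "bij_betw p {k. k < n \<and> \<tau> < (a \<circ> p) k} {k. k < n \<and> \<tau> < a k}" for \<tau>
  proof (rule bij_betwI')
    fix y assume "y \<in> {k. k < n \<and> \<tau> < a k}"
    then show "\<exists>x\<in>{k. k < n \<and> \<tau> < (a \<circ> p) k}. y = p x"
      using permutes_surj[OF assms(2)] lt by (auto simp: surj_def) metis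
  qed (use lt permutes_inj[OF assms(2)] in \<open>auto dest: injD\<close>)
  then have "card {k. k < n \<and> \<tau> < (a \<circ> p) k} = card {k. k < n \<and> \<tau> < a k}" for \<tau>
    by (rule bij_betw_same_card)
  then show ?thesis using assms lt by (intro antisym M_step_le_of_card_le) auto
qed

text \<open>A transfer replaces \<open>b\<close> by a convex combination of \<open>b\<close> and
  \<open>b\<close> with entries i and j swapped, of weight \<open>r = t / (b i - b j)\<close> on the
  swap. Both have the same \<open>M\<close>, so subadditivity and homogeneity suffice. If the two
  entries agree, then t = 0.\<close>

lemma M_step_transfer:
  assumes d: "0 < d" and ij: "i < n" "j < n" "i \<noteq> j" and b: "\<And>k. k < n \<Longrightarrow> 0 \<le> b k"
    and t: "0 \<le> t" "t \<le> b i - b j"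
  shows "M (step d n (b(i := b i - t, j := b j + t))) \<le> M (step d n b)"
proof (cases "b i = b j")
  case True
  then have "b(i := b i - t, j := b j + t) = b" using t by auto
  then show ?thesis by simp
next
  case False
  define r where "r = t / (b i - b j)"
  define p where "p = Transposition.transpose i j"
  have r: "0 \<le> r" "r \<le> 1" and rt: "r * (b i - b j) = t" using t False by (auto simp: r_def field_simps)
  have p: "p permutes {..<n}" using ij by (auto simp: p_def intro: permutes_swap_id)
  have pn: "p k < n" if "k < n" for k using permutes_in_image[OF p, of k] that by simp
  have eq: "(b(i := b i - t, j := b j + t)) k = (1 - r) * b k + r * (b \<circ> p) k" for k
    using rt ij by (auto simp: p_def Transposition.transpose_def algebra_simps)
  have step_eq: "step d n (b(i := b i - t, j := b j + t)) = (\<lambda>x. (1 - r) * step d n b x + r * step d n (b \<circ> p) x)"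
    unfolding step_def[abs_def] sum_distrib_left sum.distrib[symmetric] eq distrib_right mult.assoc ..
  have "M (step d n (b(i := b i - t, j := b j + t)))
      \<le> M (\<lambda>x. (1 - r) * step d n b x) + M (\<lambda>x. r * step d n (b \<circ> p) x)"
    unfolding step_eq using r b pn by (intro M_add_le) (auto intro!: mult_nonneg_nonneg step_nonneg)
  also have "\<dots> = ennreal (1 - r) * M (step d n b) + ennreal r * M (step d n b)"
    using r M_step_permute[OF d p b] by (simp add: M_scale meas0_borel)
  also have "\<dots> = M (step d n b)"
    using r by (simp flip: distrib_right ennreal_plus)
  finally show ?thesis .
qed

lemma M_step_mono:
  assumes "\<And>k. k < n \<Longrightarrow> 0 \<le> a k \<and> a k \<le> b k"
  shows "M (step d n a) \<le> M (step d n b)"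
  using assms by (intro M_mono) (auto intro!: meas0_borel step_mono step_nonneg)

text \<open>Sorting \<open>a\<close> changes neither its excess sums nor \<open>M\<close> of its
  step function; after sorting, the excess inequalities become prefix inequalities and the transfers
  apply.\<close>

lemma M_step_le_of_excess_le:
  assumes d: "0 < d" and a: "\<And>k. k < n \<Longrightarrow> 0 \<le> a k"
    and b: "\<And>i j. i \<le> j \<Longrightarrow> j < n \<Longrightarrow> b j \<le> b i" "\<And>k. k < n \<Longrightarrow> 0 < b k"
    and excess: "\<And>c. 0 < c \<Longrightarrow> (\<Sum>k<n. max 0 (a k - c)) \<le> (\<Sum>k<n. max 0 (b k - c))"
  shows "M (step d n a) \<le> M (step d n b)"
proof -
  obtain p where p: "p permutes {..<n}" "\<And>i j. i \<le> j \<Longrightarrow> j < n \<Longrightarrow> a (p j) \<le> a (p i)"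
    using exists_antitone_permutation[of n a] by blast
  have pn: "p k < n" if "k < n" for k using permutes_in_image[OF p(1), of k] that by simp
  have "(\<Sum>k<n. max 0 ((a \<circ> p) k - c)) = (\<Sum>k<n. max 0 (a k - c))" for c
    using sum.permute[OF p(1), of "\<lambda>k. max 0 (a k - c)"] by (simp add: o_def)
  then have "(\<Sum>k<l. (a \<circ> p) k) \<le> (\<Sum>k<l. b k)" if "l \<le> n" for l
    using excess by (intro prefix_sum_le_of_excess_le[OF b _ that]) simp_all
  then have "M (step d n (a \<circ> p)) \<le> M (step d n b)"
    using p(2) a b(2) pn
    by (intro transfer_majorization[where \<phi> = "\<lambda>a. M (step d n a)" and n = n, OF M_step_mono M_step_transfer[OF d]])
       (simp_all add: less_imp_le)
  then show ?thesis using M_step_permute[OF d p(1) a] by simp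
qed

section \<open>Countable covers, tails and the passage to continuous functions\<close>

lemma M_sum_le_finite:
  assumes "finite I" "\<And>k x. k \<in> I \<Longrightarrow> 0 \<le> h k x"
  shows "M (\<lambda>x. \<Sum>k\<in>I. h k x) \<le> (\<Sum>k\<in>I. M (h k))"
  using assms
proof (induction I rule: finite_induct)
  case empty
  show ?case using M_sum_le[of 0 "\<lambda>_ _. 0"] by simp
next
  case (insert i I)
  have "M (\<lambda>x. \<Sum>k\<in>insert i I. h k x) \<le> M (h i) + M (\<lambda>x. \<Sum>k\<in>I. h k x)"
    using insert M_add_le[of "h i" "\<lambda>x. \<Sum>k\<in>I. h k x"] by (simp add: sum_nonneg)
  also have "\<dots> \<le> M (h i) + (\<Sum>k\<in>I. M (h k))"
    using insert by (intro add_left_mono) auto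
  finally show ?case using insert by simp
qed

lemma N_sqrt_le_of_M_le:
  assumes "M h \<le> ennreal S" "0 \<le> S"
  shows "N (\<lambda>x. sqrt (h x)) \<le> ennreal (sqrt S)"
  using assms by (subst ennreal_power2_le_iff[symmetric]) (simp add: M_def ennreal_power)

text \<open>No Fatou property is assumed, so passing to the limit has to go through completeness.\<close>
lemma M_le_of_countable_cover:
  assumes h: "\<And>k x. 0 \<le> h k x" "\<And>k. meas0 (h k)" "\<And>k. M (h k) \<le> ennreal (m k)"
    and m: "\<And>k. 0 \<le> m k" "summable m"
    and H: "meas0 H" "\<And>x. 0 < x \<Longrightarrow> 0 \<le> H x" "\<And>x. 0 < x \<Longrightarrow> \<exists>n. H x \<le> (\<Sum>k<n. h k x)"
  shows "M H \<le> ennreal (\<Sum>k. m k)"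
proof -
  define F where "F n x = sqrt (\<Sum>k<n. h k x)" for n :: nat and x
  have block: "N (\<lambda>x. sqrt (\<Sum>k\<in>I. h k x)) \<le> ennreal (sqrt (\<Sum>k\<in>I. m k))" if "finite I" for I
  proof (rule N_sqrt_le_of_M_le)
    have "M (\<lambda>x. \<Sum>k\<in>I. h k x) \<le> (\<Sum>k\<in>I. M (h k))" using h that by (intro M_sum_le_finite) auto
    also have "\<dots> \<le> (\<Sum>k\<in>I. ennreal (m k))" by (intro sum_mono h)
    finally show "M (\<lambda>x. \<Sum>k\<in>I. h k x) \<le> ennreal (\<Sum>k\<in>I. m k)" using m by simp
  qed (simp add: sum_nonneg m)
  have Fmeas: "meas0 (F n)" for n unfolding F_def by (intro meas0_sqrt meas0_sum h)
  have FN: "N (F n) \<le> ennreal (sqrt (\<Sum>k. m k))" for n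
  proof -
    have "N (F n) \<le> ennreal (sqrt (\<Sum>k<n. m k))" using block[of "{..<n}"] by (simp add: F_def[abs_def])
    also have "\<dots> \<le> ennreal (sqrt (\<Sum>k. m k))"
      using m by (intro ennreal_leI real_sqrt_le_mono sum_le_suminf) auto
    finally show ?thesis .
  qed
  have Fmono: "F n x \<le> F l x" if "n \<le> l" for n l x
    unfolding F_def using that h by (intro real_sqrt_le_mono sum_mono2) auto
  \<comment> \<open>Subadditivity of the square root bounds the increment by the root of a block
    sum, so its norm is controlled by a Cauchy block of the series of \<open>m\<close>.\<close>
  have Fdiff: "N (\<lambda>x. F l x - F n x) \<le> ennreal (sqrt (\<Sum>k=n..<l. m k))" if "n \<le> l" for n l
  proof -
    have "N (\<lambda>x. F l x - F n x) \<le> N (\<lambda>x. sqrt (\<Sum>k=n..<l. h k x))"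
    proof (rule N_mono)
      fix x :: real
      have "(\<Sum>k<l. h k x) = (\<Sum>k<n. h k x) + (\<Sum>k=n..<l. h k x)"
        using that sum.atLeastLessThan_concat[of 0 n l "\<lambda>k. h k x"] by (simp add: atLeast0LessThan)
      then have "F l x \<le> F n x + sqrt (\<Sum>k=n..<l. h k x)"
        unfolding F_def using h by (simp add: sqrt_add_le_add_sqrt sum_nonneg)
      then show "\<bar>F l x - F n x\<bar> \<le> \<bar>sqrt (\<Sum>k=n..<l. h k x)\<bar>"
        using Fmono[OF that, of x] h by (simp add: sum_nonneg)
    qed (intro meas0_diff Fmeas meas0_sqrt meas0_sum h)+
    also have "\<dots> \<le> ennreal (sqrt (\<Sum>k=n..<l. m k))" by (rule block) simp
    finally show ?thesis .
  qed
  have Fsym: "N (\<lambda>x. f x - g x) \<le> N (\<lambda>x. g x - f x)" if "meas0 f" "meas0 g" for f g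
    using that by (intro N_mono meas0_diff) (auto simp: abs_minus_commute)
  obtain f where f: "N f < \<infinity>" "(\<lambda>n. N (\<lambda>x. F n x - f x)) \<longlonglongrightarrow> 0"
  proof (rule N_complete)
    show "N (F n) < \<infinity>" for n using FN[of n] by (simp add: le_less_trans)
    fix e :: real assume e: "0 < e"
    then obtain K where K: "\<And>n l. K \<le> n \<Longrightarrow> norm (sum m {n..<l}) < e\<^sup>2"
      using m(2) unfolding summable_Cauchy by (meson zero_less_power)
    have *: "N (\<lambda>x. F l x - F n x) < ennreal e" if "K \<le> n" "n \<le> l" for n l
    proof -
      have "sqrt (\<Sum>k=n..<l. m k) < e"
        using K[OF that(1), of l] e real_sqrt_less_iff[of _ "e\<^sup>2"] m(1) by (simp add: sum_nonneg)
      then show ?thesis using Fdiff[OF that(2)] e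
        by (meson ennreal_lessI le_less_trans)
    qed
    have "N (\<lambda>x. F l x - F n x) < ennreal e" if "K \<le> n" "K \<le> l" for n l
      using *[of n l] *[of l n] Fsym[of "F l" "F n"] that Fmeas by (meson le_less_trans nle_le)
    then show "\<exists>K. \<forall>m\<ge>K. \<forall>n\<ge>K. N (\<lambda>x. F m x - F n x) < ennreal e" by blast
  qed
  have fmeas: "meas0 f" using f(1) by (rule meas0_of_finite)
  \<comment> \<open>For every l from n on, the positive part of \<open>F n - f\<close> is below
    \<open>\<bar>F l - f\<bar>\<close>, whose norm tends to 0. So the norm limit dominates all
    partial sums almost everywhere.\<close>
  have "AE x in lebesgue. x > 0 \<longrightarrow> F n x \<le> f x" for n
  proof -
    have p: "meas0 (\<lambda>x. max 0 (F n x - f x))"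
      using Fmeas[of n] fmeas unfolding meas0_def by measurable
    have "N (\<lambda>x. max 0 (F n x - f x)) \<le> N (\<lambda>x. F l x - f x)" if "n \<le> l" for l
    proof (rule N_mono)
      show "\<bar>max 0 (F n x - f x)\<bar> \<le> \<bar>F l x - f x\<bar>" for x using Fmono[OF that, of x] by linarith
    qed (intro p meas0_diff Fmeas fmeas)+
    then have "N (\<lambda>x. max 0 (F n x - f x)) \<le> 0"
      by (intro LIMSEQ_le_const[OF f(2)] exI[of _ n]) simp
    then have "AE x in lebesgue. x > 0 \<longrightarrow> max 0 (F n x - f x) = 0" using N_eq_0_iff[OF p] by simp
    then show ?thesis by eventually_elim (auto simp: max_def split: if_splits)
  qed
  then have "AE x in lebesgue. \<forall>n. x > 0 \<longrightarrow> F n x \<le> f x" by (subst AE_all_countable) blast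
  then have "AE x in lebesgue. x > 0 \<longrightarrow> \<bar>sqrt (H x)\<bar> \<le> \<bar>f x\<bar>"
  proof eventually_elim
    case (elim x)
    show ?case
    proof
      assume x: "x > 0"
      then obtain n where "H x \<le> (\<Sum>k<n. h k x)" using H(3) by blast
      then have "sqrt (H x) \<le> F n x" unfolding F_def by simp
      then show "\<bar>sqrt (H x)\<bar> \<le> \<bar>f x\<bar>" using elim x H(2)[OF x] by (smt (verit) real_sqrt_ge_zero)
    qed
  qed
  then have "N (\<lambda>x. sqrt (H x)) \<le> N f" by (intro N_mono_AE fmeas meas0_sqrt H)
  also have "N f \<le> ennreal (sqrt (\<Sum>k. m k))"
  proof (rule LIMSEQ_le_const)
    show "(\<lambda>n. ennreal (sqrt (\<Sum>k. m k)) + N (\<lambda>x. F n x - f x)) \<longlonglongrightarrow> ennreal (sqrt (\<Sum>k. m k))"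
      using tendsto_add[OF tendsto_const f(2)] by simp
    have "N f \<le> N (F n) + N (\<lambda>x. f x - F n x)" for n using N_add_le[of "F n" "\<lambda>x. f x - F n x"] by simp
    also have "N (F n) + N (\<lambda>x. f x - F n x) \<le> ennreal (sqrt (\<Sum>k. m k)) + N (\<lambda>x. F n x - f x)" for n
      by (intro add_mono FN Fsym Fmeas fmeas)
    finally show "\<exists>K. \<forall>n\<ge>K. N f \<le> ennreal (sqrt (\<Sum>k. m k)) + N (\<lambda>x. F n x - f x)" by blast
  qed
  finally have "M H \<le> (ennreal (sqrt (\<Sum>k. m k)))\<^sup>2" unfolding M_def by (rule power_mono) simp
  then show ?thesis using m by (simp add: ennreal_power suminf_nonneg)
qed

text \<open>Unit cells are equimeasurable; written as a step function with values 0, ..., 0, 1, a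
  cell can be compared with the first one by counting.\<close>

lemma M_unit_cell_le: "M (indicator (cell 1 j)) \<le> M (step 1 1 (\<lambda>_. 1))"
proof -
  have eq: "indicator (cell 1 j) = step 1 (Suc j) (\<lambda>k. of_bool (k = j))"
    by (rule ext) (simp add: step_def)
  show ?thesis unfolding eq
  proof (rule M_step_le_of_card_le)
    fix \<tau> :: real assume "0 < \<tau>"
    then have "{k. k < Suc j \<and> \<tau> < of_bool (k = j)} = (if \<tau> < 1 then {j} else {})" by auto
    then show "card {k. k < Suc j \<and> \<tau> < of_bool (k = j)} \<le> card {k::nat. k < 1 \<and> \<tau> < 1}"
      by auto
  qed auto
qed

text \<open>The constant on the small cells is dominated by e times the indicator of (0, T], a sum
  of T unit cells each of \<open>M\<close> at most \<kappa>.\<close>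

lemma M_step_const_le:
  assumes d: "0 < d" "d * real n \<le> real T" and e: "0 \<le> e"
    and \<kappa>: "M (step 1 1 (\<lambda>_. 1)) \<le> ennreal \<kappa>" "0 \<le> \<kappa>"
  shows "M (step d n (\<lambda>_. e)) \<le> ennreal (\<kappa> * (e * real T))"
proof -
  have "M (step d n (\<lambda>_. e)) \<le> M (\<lambda>x. e * step 1 T (\<lambda>_. 1) x)"
  proof (rule M_mono)
    fix x :: real assume x: "0 < x"
    show "0 \<le> step d n (\<lambda>_. e) x \<and> step d n (\<lambda>_. e) x \<le> e * step 1 T (\<lambda>_. 1) x"
    proof (cases "\<exists>k<n. x \<in> cell d k")
      case True
      then obtain k where k: "k < n" "x \<in> cell d k" by blast
      then have "x \<le> d * real (Suc k)" by (simp add: cell_def)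
      also have "\<dots> \<le> d * real n" using k d by (intro mult_left_mono) auto
      finally have "x \<le> 1 * real T" using d by simp
      then obtain j where "j < T" "x \<in> cell 1 j" using cell_exists[of 1 x T] x by auto
      then show ?thesis using k d e step_in_cell[of 1 x j T] step_in_cell[of d x k n] by simp
    next
      case False
      then have "step d n (\<lambda>_. e) x = 0" by (intro step_outside) auto
      then show ?thesis using e by (auto intro!: mult_nonneg_nonneg step_nonneg)
    qed
  qed (auto intro!: meas0_borel)
  also have "\<dots> = ennreal e * M (step 1 T (\<lambda>_. 1))" using e by (intro M_scale meas0_borel) auto
  also have "M (step 1 T (\<lambda>_. 1)) \<le> (\<Sum>k<T. M (indicator (cell 1 k)))"
    unfolding step_def[abs_def] mult_1 by (rule M_sum_le) simp
  also have "\<dots> \<le> (\<Sum>k<T. ennreal \<kappa>)"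
    by (intro sum_mono order_trans[OF M_unit_cell_le] \<kappa>)
  also have "ennreal e * (\<Sum>k<T. ennreal \<kappa>) = ennreal (\<kappa> * (e * real T))"
    using e \<kappa> by (simp add: ennreal_of_nat_eq_real_of_nat mult_ac flip: ennreal_mult)
  finally show ?thesis by (simp add: mult_left_mono)
qed

text \<open>Cover the half-line beyond T by unit cells, each carrying a constant bound for
  \<open>u\<close>. Decay of order \<open>t^-2\<close> makes these constants summable, and
  \<open>T \<ge> 2\<close> keeps the denominators positive.\<close>

lemma M_tail_le:
  assumes u: "u \<in> borel_measurable borel" "\<And>t. 0 \<le> u t" "\<And>t. 0 < t \<Longrightarrow> u t \<le> C / t\<^sup>2"
    and C: "0 \<le> C" and T: "2 \<le> T"
    and \<kappa>: "M (step 1 1 (\<lambda>_. 1)) \<le> ennreal \<kappa>" "0 \<le> \<kappa>"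
  shows "M (\<lambda>x. u x * indicator {real T<..} x) \<le> ennreal (\<kappa> * (C / (real T - 1)))"
proof -
  \<comment> \<open>A telescoping majorant of \<open>C / (k + T)^2\<close>, with sum
    \<open>C / (T - 1)\<close>.\<close>
  define q where "q k = C * (1 / (real (k + T) - 1) - 1 / real (k + T))" for k
  have q: "0 \<le> q k" for k
    unfolding q_def using C T by (intro mult_nonneg_nonneg) (auto intro!: divide_left_mono mult_pos_pos)
  have "(\<lambda>k. 1 / (real (k + T) - 1)) \<longlonglongrightarrow> 0" by real_asymp
  then have "(\<lambda>k. 1 / (real (k + T) - 1) - 1 / (real (Suc k + T) - 1)) sums (1 / (real (0 + T) - 1) - 0)"
    by (rule telescope_sums')
  then have "(\<lambda>k. \<kappa> * (C * (1 / (real (k + T) - 1) - 1 / (real (Suc k + T) - 1)))) sums (\<kappa> * (C * (1 / (real (0 + T) - 1) - 0)))"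
    by (intro sums_mult)
  then have sums: "(\<lambda>k. \<kappa> * q k) sums (\<kappa> * (C / (real T - 1)))" by (simp add: q_def)
  have "M (\<lambda>x. u x * indicator {real T<..} x) \<le> ennreal (\<Sum>k. \<kappa> * q k)"
  proof (rule M_le_of_countable_cover[where h = "\<lambda>k x. q k * indicator (cell 1 (k + T)) x"])
    show "0 \<le> q k * indicator (cell 1 (k + T)) x" for k x using q by simp
    show "meas0 (\<lambda>x. q k * indicator (cell 1 (k + T)) x)" for k by (intro meas0_borel) measurable
    show "M (\<lambda>x. q k * indicator (cell 1 (k + T)) x) \<le> ennreal (\<kappa> * q k)" for k
    proof -
      have "M (\<lambda>x. q k * indicator (cell 1 (k + T)) x) = ennreal (q k) * M (indicator (cell 1 (k + T)))"
        by (intro M_scale meas0_borel q) measurable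
      also have "\<dots> \<le> ennreal (q k) * ennreal \<kappa>"
        by (intro mult_left_mono order_trans[OF M_unit_cell_le] \<kappa>) simp
      finally show ?thesis using q \<kappa> by (simp add: ennreal_mult[symmetric] mult.commute)
    qed
    show "0 \<le> \<kappa> * q k" for k using q \<kappa> by simp
    show "summable (\<lambda>k. \<kappa> * q k)" using sums by (rule sums_summable)
    show "meas0 (\<lambda>x. u x * indicator {real T<..} x)" by (intro meas0_borel borel_measurable_times u(1) borel_measurable_indicator) simp
    show "0 \<le> u x * indicator {real T<..} x" for x by (intro mult_nonneg_nonneg u(2)) simp
    fix x :: real assume x: "0 < x"
    show "\<exists>n. u x * indicator {real T<..} x \<le> (\<Sum>k<n. q k * indicator (cell 1 (k + T)) x)"
    proof (cases "real T < x")
      case True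
      obtain n where "x \<le> 1 * real n" using real_arch_simple[of x] by auto
      then obtain j where j: "x \<in> cell 1 j" using cell_exists[of 1 x n] x by auto
      have "T \<le> j"
      proof -
        have "real T < real (Suc j)" using j True by (simp add: cell_def)
        then show ?thesis by simp
      qed
      then obtain i where i: "j = i + T" using le_Suc_ex[of T j] by (auto simp: add.commute)
      have pos: "1 < real (i + T)" using T by simp
      have "real (i + T) < x" using j i by (simp add: cell_def)
      have "u x \<le> C / x\<^sup>2" using u(3)[OF x] .
      also have "\<dots> \<le> C / (real (i + T))\<^sup>2"
        using C pos \<open>real (i + T) < x\<close> by (intro divide_left_mono power_mono mult_pos_pos) auto
      also have "\<dots> \<le> q i"
      proof -
        have "1 / y\<^sup>2 \<le> 1 / (y - 1) - 1 / y" if "1 < y" for y :: real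
          using that by (simp add: field_simps power2_eq_square)
        from mult_left_mono[OF this[OF pos] C] show ?thesis by (simp add: q_def)
      qed
      also have "q i = q i * indicator (cell 1 (i + T)) x" using j i by simp
      also have "\<dots> \<le> (\<Sum>k<Suc i. q k * indicator (cell 1 (k + T)) x)"
        by (rule member_le_sum) (simp_all add: q)
      finally show ?thesis using True by (intro exI[of _ "Suc i"]) simp
    next
      case False
      then show ?thesis by (intro exI[of _ 0]) simp
    qed
  qed
  then show ?thesis using sums_unique[OF sums] by simp
qed

text \<open>Sample both functions at right endpoints of cells filling (0, T], lowering
  \<open>u\<close> and raising \<open>v\<close> so that the excess inequalities survive
  discretization. The price is \<open>M\<close> of small constants on (0, T] and of the tail of
  \<open>u\<close>, all measured by the bound \<kappa> for a unit cell.\<close>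

lemma M_le_of_excess_le_approx:
  fixes u v :: "real \<Rightarrow> real"
  assumes u: "continuous_on UNIV u" "\<And>t. 0 \<le> u t" "\<And>t. 0 < t \<Longrightarrow> u t \<le> C / t\<^sup>2"
    and v: "continuous_on UNIV v" "\<And>t. 0 < v t" "\<And>t. 0 < t \<Longrightarrow> v t \<le> C / t\<^sup>2"
      "\<And>s t. 0 \<le> s \<Longrightarrow> s \<le> t \<Longrightarrow> v t \<le> v s"
    and excess: "\<And>c T. 0 < c \<Longrightarrow> 0 \<le> T \<Longrightarrow> \<exists>S\<ge>0. integral {0..T} (\<lambda>t. max 0 (u t - c))
        \<le> integral {0..S} (\<lambda>t. max 0 (v t - c))"
    and \<kappa>: "M (step 1 1 (\<lambda>_. 1)) \<le> ennreal \<kappa>" "0 \<le> \<kappa>"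
    and T: "2 \<le> T" and e: "0 < e"
  shows "M u \<le> M v + ennreal (\<kappa> * (3 * e * real T + C / real T + C / (real T - 1)))"
proof -
  have C: "0 \<le> C" using v(2)[of 1] v(3)[of 1] by simp
  have Tpos: "0 < real T" using T by simp
  have unif: "\<exists>r>0. \<forall>x\<in>{0..real T}. \<forall>y\<in>{0..real T}. \<bar>x - y\<bar> < r \<longrightarrow> \<bar>f x - f y\<bar> < e"
    if "continuous_on UNIV f" for f :: "real \<Rightarrow> real"
  proof -
    have "uniformly_continuous_on {0..real T} f"
      using that by (intro compact_uniformly_continuous) (auto intro: continuous_on_subset)
    then show ?thesis using e unfolding uniformly_continuous_on_def dist_real_def
      by (meson abs_minus_commute)
  qed
  obtain r1 where r1: "0 < r1" "\<And>x y. x \<in> {0..real T} \<Longrightarrow> y \<in> {0..real T} \<Longrightarrow> \<bar>x - y\<bar> < r1 \<Longrightarrow> \<bar>u x - u y\<bar> < e"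
    using unif[OF u(1)] by blast
  obtain r2 where r2: "0 < r2" "\<And>x y. x \<in> {0..real T} \<Longrightarrow> y \<in> {0..real T} \<Longrightarrow> \<bar>x - y\<bar> < r2 \<Longrightarrow> \<bar>v x - v y\<bar> < e"
    using unif[OF v(1)] by blast
  obtain m where m: "m \<noteq> 0" "inverse (real m) < min r1 r2"
    using real_arch_inverse[of "min r1 r2"] r1 r2 by auto
  define d where "d = inverse (real m)"
  \<comment> \<open>With cell length 1/m, this number of cells fills (0, T] exactly.\<close>
  define n where "n = T * m"
  have d: "0 < d" "d < r1" "d < r2" using m by (auto simp: d_def)
  have dn: "d * real n = real T" using m by (simp add: d_def n_def)
  have cellT: "{d * real k..d * real (Suc k)} \<subseteq> {0..real T}" if "k < n" for k
  proof -
    have "d * real (Suc k) \<le> d * real n" using that d by (intro mult_left_mono) auto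
    then show ?thesis using d dn by (auto intro: order_trans[of 0 "d * real k"])
  qed
  have close: "\<bar>u t - u (d * real (Suc k))\<bar> < e" "\<bar>v t - v (d * real (Suc k))\<bar> < e"
    if "k < n" "t \<in> {d * real k..d * real (Suc k)}" for k t
  proof -
    have "d * real (Suc k) \<in> {d * real k..d * real (Suc k)}" using d by simp
    then have in_T: "t \<in> {0..real T}" "d * real (Suc k) \<in> {0..real T}" using cellT[OF that(1)] that(2) by blast+
    have "\<bar>t - d * real (Suc k)\<bar> \<le> d" using that(2) by (auto simp: algebra_simps)
    then show "\<bar>u t - u (d * real (Suc k))\<bar> < e" "\<bar>v t - v (d * real (Suc k))\<bar> < e"
      using r1(2)[OF in_T] r2(2)[OF in_T] d by auto
  qed
  have cell_sub: "x \<in> {d * real k..d * real (Suc k)}" if "x \<in> cell d k" for x k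
    using that by (auto simp: cell_def)
  \<comment> \<open>The shift by e puts \<open>a k\<close> below \<open>u\<close> on the k-th cell,
    while \<open>u\<close> exceeds it there by less than 2e; this is the later error term
    \<open>2 * e\<close>. Truncation at 0 keeps the step function nonnegative.\<close>
  define a where "a k = max 0 (u (d * real (Suc k)) - e)" for k
  define \<beta> where "\<beta> k = v (d * real (Suc k))" for k
  \<comment> \<open>Raising \<open>v\<close> by \<open>\<eta>\<close> on \<open>(0, T]\<close> pays for the mass that \<open>v\<close> has beyond \<open>T\<close>.\<close>
  define \<eta> where "\<eta> = C / (real T)\<^sup>2"
  define b where "b k = \<beta> k + (e + \<eta>)" for k
  have \<eta>: "0 \<le> \<eta>" using C by (simp add: \<eta>_def)
  have \<beta>_anti: "\<beta> j \<le> \<beta> i" if "i \<le> j" for i j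
    unfolding \<beta>_def using that d by (intro v(4) mult_left_mono) auto
  have excess_sum: "(\<Sum>k<n. max 0 (a k - c)) \<le> (\<Sum>k<n. max 0 (b k - c))" if c: "0 < c" for c
  proof -
    have cont: "continuous_on UNIV (\<lambda>t. max 0 (f t - c))" if "continuous_on UNIV f" for f :: "real \<Rightarrow> real"
      using that by (intro continuous_intros)
    have "d * (\<Sum>k<n. max 0 (a k - c)) \<le> integral {0..real T} (\<lambda>t. max 0 (u t - c))"
      unfolding dn[symmetric] integral_cells[OF cont[OF u(1)] less_imp_le[OF d(1)]] sum_distrib_left
    proof (intro sum_mono integral_cell_ge[OF cont[OF u(1)] less_imp_le[OF d(1)]])
      fix k t assume "k \<in> {..<n}" "t \<in> {d * real k..d * real (Suc k)}"
      then have "\<bar>u t - u (d * real (Suc k))\<bar> < e" by (intro close) auto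
      then show "max 0 (a k - c) \<le> max 0 (u t - c)" using u(2)[of t] by (simp add: a_def)
    qed
    also obtain S where "0 \<le> S"
      "integral {0..real T} (\<lambda>t. max 0 (u t - c)) \<le> integral {0..S} (\<lambda>t. max 0 (v t - c))"
      using excess[OF c, of "real T"] by auto
    note this(2)
    also have "integral {0..S} (\<lambda>t. max 0 (v t - c))
      \<le> integral {0..real T} (\<lambda>t. max 0 (v t - c)) + (if c < v (real T) then C / real T else 0)"
      by (rule integral_excess_tail_le[OF v(1,3,4) C Tpos \<open>0 \<le> S\<close> c])
    also have "integral {0..real T} (\<lambda>t. max 0 (v t - c)) \<le> d * (\<Sum>k<n. max 0 (\<beta> k + e - c))"
      unfolding dn[symmetric] integral_cells[OF cont[OF v(1)] less_imp_le[OF d(1)]] sum_distrib_left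
    proof (intro sum_mono integral_cell_le[OF cont[OF v(1)] less_imp_le[OF d(1)]])
      fix k t assume "k \<in> {..<n}" "t \<in> {d * real k..d * real (Suc k)}"
      then have "\<bar>v t - v (d * real (Suc k))\<bar> < e" by (intro close) auto
      then show "max 0 (v t - c) \<le> max 0 (\<beta> k + e - c)" by (simp add: \<beta>_def)
    qed
    \<comment> \<open>If \<open>c < v T\<close>, every sample of \<open>v\<close> exceeds c, so all
      n cells gain the full \<eta>, in total \<open>T * \<eta> = C / T\<close>, which is the tail
      term. Otherwise there is no tail term and monotonicity is enough.\<close>
    also have "d * (\<Sum>k<n. max 0 (\<beta> k + e - c)) + (if c < v (real T) then C / real T else 0)
        \<le> d * (\<Sum>k<n. max 0 (b k - c))"
    proof (cases "c < v (real T)")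
      case True
      have "max 0 (b k - c) = max 0 (\<beta> k + e - c) + \<eta>" if "k < n" for k
      proof -
        have "d * real (Suc k) \<in> {d * real k..d * real (Suc k)}" using d by simp
        then have "v (real T) \<le> \<beta> k" unfolding \<beta>_def using cellT[OF that] by (intro v(4)) auto
        then show ?thesis using True e \<eta> by (simp add: b_def)
      qed
      then have "d * (\<Sum>k<n. max 0 (b k - c)) = d * (\<Sum>k<n. max 0 (\<beta> k + e - c)) + (d * real n) * \<eta>"
        by (simp add: sum.distrib algebra_simps)
      also have "(d * real n) * \<eta> = C / real T"
        using Tpos by (simp add: dn \<eta>_def power2_eq_square)
      finally show ?thesis using True by simp
    next
      case False
      then show ?thesis using d \<eta> by (auto simp: b_def intro!: mult_left_mono sum_mono)
    qed
    finally show ?thesis using d by simp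
  qed
  have step_a: "M (step d n a) \<le> M (step d n b)"
  proof (rule M_step_le_of_excess_le[OF d(1) _ _ _ excess_sum])
    show "0 \<le> a k" for k by (simp add: a_def)
    show "b j \<le> b i" if "i \<le> j" for i j using \<beta>_anti[OF that] by (simp add: b_def)
    show "0 < b k" for k using v(2)[of "d * real (Suc k)"] e \<eta> unfolding b_def \<beta>_def by linarith
  qed
  have \<beta>_nonneg: "0 \<le> \<beta> k" for k unfolding \<beta>_def by (rule less_imp_le[OF v(2)])
  have "step d n b = (\<lambda>x. step d n \<beta> x + step d n (\<lambda>_. e + \<eta>) x)"
    by (rule ext) (simp only: step_def b_def distrib_right sum.distrib)
  then have "M (step d n b) \<le> M (step d n \<beta>) + M (step d n (\<lambda>_. e + \<eta>))"
    using M_add_le[of "step d n \<beta>" "step d n (\<lambda>_. e + \<eta>)"] \<beta>_nonneg e \<eta> by (simp add: step_nonneg)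
  \<comment> \<open>The right endpoint of a cell gives the least value there of the decreasing
    \<open>v\<close>.\<close>
  also have "M (step d n \<beta>) \<le> M v"
  proof (rule M_mono)
    fix x :: real assume "0 < x"
    have "step d n \<beta> x \<le> v x"
    proof (cases "\<exists>k<n. x \<in> cell d k")
      case True
      then obtain k where k: "k < n" "x \<in> cell d k" by blast
      have "v (d * real (Suc k)) \<le> v x" using cell_sub[OF k(2)] \<open>0 < x\<close> by (intro v(4)) auto
      then show ?thesis using step_in_cell[OF d(1) k(2,1)] by (simp add: \<beta>_def)
    next
      case False
      then show ?thesis using step_outside[of n x d \<beta>] v(2)[of x] by (auto simp: less_imp_le)
    qed
    then show "0 \<le> step d n \<beta> x \<and> step d n \<beta> x \<le> v x" using \<beta>_nonneg by (simp add: step_nonneg)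
  next
    show "meas0 (step d n \<beta>)" by (rule meas0_borel[OF step_measurable])
    show "meas0 v" by (rule meas0_borel[OF borel_measurable_continuous_onI[OF v(1)]])
  qed
  also have "M (step d n (\<lambda>_. e + \<eta>)) \<le> ennreal (\<kappa> * ((e + \<eta>) * real T))"
    using e \<eta> dn by (intro M_step_const_le d \<kappa>) auto
  finally have step_b: "M (step d n b) \<le> M v + ennreal (\<kappa> * ((e + \<eta>) * real T))"
    by (simp add: add_mono)
  define w where "w x = u x * indicator {real T<..} x" for x
  have w: "0 \<le> w x" for x unfolding w_def by (intro mult_nonneg_nonneg u(2)) simp
  have ub: "u \<in> borel_measurable borel" by (rule borel_measurable_continuous_onI[OF u(1)])
  have wb: "w \<in> borel_measurable borel"
    unfolding w_def by (intro borel_measurable_times ub borel_measurable_indicator) simp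
  have a0: "0 \<le> a k" for k by (simp add: a_def)
  have "M u \<le> M (\<lambda>x. (step d n a x + step d n (\<lambda>_. 2 * e) x) + w x)"
  proof (rule M_mono)
    fix x :: real assume x: "0 < x"
    have "u x \<le> (step d n a x + step d n (\<lambda>_. 2 * e) x) + w x"
    proof (cases "x \<le> real T")
      case True
      then obtain k where k: "k < n" "x \<in> cell d k" using cell_exists[of d x n] d x dn by auto
      have "\<bar>u x - u (d * real (Suc k))\<bar> < e" using k cell_sub by (intro close)
      then show ?thesis using step_in_cell[OF d(1) k(2,1)] w[of x] unfolding a_def by simp
    next
      case False
      then have "w x = u x" by (simp add: w_def)
      then show ?thesis using a0 e by (simp add: step_nonneg)
    qed
    then show "0 \<le> u x \<and> u x \<le> (step d n a x + step d n (\<lambda>_. 2 * e) x) + w x" using u(2) by blast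
  next
    show "meas0 u" by (rule meas0_borel[OF ub])
    show "meas0 (\<lambda>x. (step d n a x + step d n (\<lambda>_. 2 * e) x) + w x)"
      by (intro meas0_borel borel_measurable_add step_measurable wb)
  qed
  also have "\<dots> \<le> M (\<lambda>x. step d n a x + step d n (\<lambda>_. 2 * e) x) + M w"
    using a0 e w by (intro M_add_le) (auto intro!: add_nonneg_nonneg step_nonneg)
  also have "\<dots> \<le> (M (step d n a) + M (step d n (\<lambda>_. 2 * e))) + M w"
    using a0 e by (intro add_right_mono M_add_le) (auto intro!: step_nonneg)
  also have "\<dots> \<le> ((M v + ennreal (\<kappa> * ((e + \<eta>) * real T))) + ennreal (\<kappa> * ((2 * e) * real T)))
      + ennreal (\<kappa> * (C / (real T - 1)))"
  proof (intro add_mono)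
    show "M (step d n a) \<le> M v + ennreal (\<kappa> * ((e + \<eta>) * real T))" using step_a step_b by (rule order_trans)
    show "M (step d n (\<lambda>_. 2 * e)) \<le> ennreal (\<kappa> * ((2 * e) * real T))"
      using e dn by (intro M_step_const_le d \<kappa>) auto
    show "M w \<le> ennreal (\<kappa> * (C / (real T - 1)))"
      unfolding w_def[abs_def] by (rule M_tail_le[OF ub u(2,3) C T \<kappa>])
  qed
  also have "\<dots> = M v + ennreal (\<kappa> * ((e + \<eta>) * real T) + \<kappa> * ((2 * e) * real T) + \<kappa> * (C / (real T - 1)))"
    using e \<eta> \<kappa>(2) C T by (simp add: add.assoc)
  also have "\<kappa> * ((e + \<eta>) * real T) + \<kappa> * ((2 * e) * real T) + \<kappa> * (C / (real T - 1))
      = \<kappa> * (3 * e * real T + \<eta> * real T + C / (real T - 1))" by (simp add: algebra_simps)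
  also have "\<eta> * real T = C / real T" using Tpos by (simp add: \<eta>_def power2_eq_square)
  finally show ?thesis .
qed

text \<open>Let T tend to infinity in the approximate inequality. Only the case of finite
  \<open>M v\<close> needs an argument.\<close>

lemma N_sqrt_le_of_excess_le:
  fixes u v :: "real \<Rightarrow> real"
  assumes u: "continuous_on UNIV u" "\<And>t. 0 \<le> u t" "\<And>t. 0 < t \<Longrightarrow> u t \<le> C / t\<^sup>2"
    and v: "continuous_on UNIV v" "\<And>t. 0 < v t" "\<And>t. 0 < t \<Longrightarrow> v t \<le> C / t\<^sup>2"
      "\<And>s t. 0 \<le> s \<Longrightarrow> s \<le> t \<Longrightarrow> v t \<le> v s"
    and excess: "\<And>c T. 0 < c \<Longrightarrow> 0 \<le> T \<Longrightarrow> \<exists>S\<ge>0. integral {0..T} (\<lambda>t. max 0 (u t - c))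
        \<le> integral {0..S} (\<lambda>t. max 0 (v t - c))"
  shows "N (\<lambda>t. sqrt (u t)) \<le> N (\<lambda>t. sqrt (v t))"
proof (cases "M v = \<infinity>")
  case True
  then show ?thesis by (simp add: M_def power_eq_top_ennreal)
next
  case False
  have vb: "meas0 v" by (rule meas0_borel[OF borel_measurable_continuous_onI[OF v(1)]])
  \<comment> \<open>Since \<open>v\<close> is decreasing and positive, \<open>v / v 1\<close>
    dominates the indicator of (0, 1]; finiteness of \<open>M v\<close> thus supplies
    \<kappa>.\<close>
  have "M (step 1 1 (\<lambda>_. 1)) \<le> M (\<lambda>x. 1 / v 1 * v x)"
  proof (rule M_mono)
    fix x :: real assume x: "0 < x"
    have "step 1 1 (\<lambda>_. 1) x \<le> 1 / v 1 * v x"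
      using v(4)[of x 1] v(2)[of 1] v(2)[of x] x by (auto simp: step_def cell_def indicator_def field_simps)
    then show "0 \<le> step 1 1 (\<lambda>_. 1) x \<and> step 1 1 (\<lambda>_. 1) x \<le> 1 / v 1 * v x"
      by (simp add: step_nonneg)
  next
    show "meas0 (step 1 1 (\<lambda>_. 1))" by (rule meas0_borel[OF step_measurable])
    show "meas0 (\<lambda>x. 1 / v 1 * v x)"
      by (intro meas0_borel borel_measurable_times borel_measurable_const borel_measurable_continuous_onI[OF v(1)])
  qed
  also have "\<dots> = ennreal (1 / v 1) * M v" using v(2)[of 1] by (intro M_scale vb) simp
  also have "\<dots> < \<infinity>" using False by (simp add: ennreal_mult_less_top less_top)
  finally obtain \<kappa> where \<kappa>: "M (step 1 1 (\<lambda>_. 1)) \<le> ennreal \<kappa>" "0 \<le> \<kappa>"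
    by (cases "M (step 1 1 (\<lambda>_. 1))") auto
  have "M u \<le> M v"
  proof (rule LIMSEQ_le_const)
    \<comment> \<open>The choice \<open>e = 1 / T^2\<close> makes even the error proportional to
      \<open>e * T\<close> vanish.\<close>
    have "(\<lambda>T. \<kappa> * (3 * (1 / (real T)\<^sup>2) * real T + C / real T + C / (real T - 1))) \<longlonglongrightarrow> 0"
      by real_asymp
    then show "(\<lambda>T. M v + ennreal (\<kappa> * (3 * (1 / (real T)\<^sup>2) * real T + C / real T + C / (real T - 1)))) \<longlonglongrightarrow> M v"
      using tendsto_add[OF tendsto_const[of "M v"] tendsto_ennrealI] by fastforce
    show "\<exists>K. \<forall>T\<ge>K. M u \<le> M v + ennreal (\<kappa> * (3 * (1 / (real T)\<^sup>2) * real T + C / real T + C / (real T - 1)))"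
    proof (intro exI allI impI)
      fix T :: nat assume "2 \<le> T"
      then show "M u \<le> M v + ennreal (\<kappa> * (3 * (1 / (real T)\<^sup>2) * real T + C / real T + C / (real T - 1)))"
        by (intro M_le_of_excess_le_approx[OF u v excess \<kappa>]) auto
    qed
  qed
  then show ?thesis by (simp add: M_def ennreal_power2_le_iff)
qed

end

section \<open>Submajorization of the squared sinc function by the Gaussian\<close>

text \<open>For t at most 1 all factors \<open>1 - t^2 / k^2\<close> of the sine product are
  nonnegative and at most \<open>exp (- t^2 / k^2)\<close>. The exponents add up to
  \<open>- t^2 * pi^2 / 6\<close>, and \<open>pi^2 / 6 \<ge> pi / 2\<close> because pi is at least
  3.\<close>

lemma sinc_le_gaussian:
  fixes t :: real
  assumes t: "0 < t" "t \<le> 1"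
  shows "sin (pi * t) / (pi * t) \<le> exp (- pi * t\<^sup>2 / 2)"
proof -
  have "sin (pi * t) / (pi * t) \<le> exp (- t\<^sup>2 * (pi\<^sup>2 / 6))"
  proof (rule LIMSEQ_le)
    show "(\<lambda>n. \<Prod>k=1..n. 1 - t\<^sup>2 / (of_nat k)\<^sup>2) \<longlonglongrightarrow> sin (pi * t) / (pi * t)"
      using t by (intro sin_product_formula_real') auto
    have "(\<lambda>n. \<Sum>k<n. 1 / (1 + real k)\<^sup>2) \<longlonglongrightarrow> pi\<^sup>2 / 6"
      using inverse_squares_sums by (simp add: sums_def add.commute)
    then show "(\<lambda>n. exp (- t\<^sup>2 * (\<Sum>k<n. 1 / (1 + real k)\<^sup>2))) \<longlonglongrightarrow> exp (- t\<^sup>2 * (pi\<^sup>2 / 6))"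
      by (intro tendsto_intros)
    have "(\<Prod>k=1..n. 1 - t\<^sup>2 / (real k)\<^sup>2) \<le> exp (- t\<^sup>2 * (\<Sum>k<n. 1 / (1 + real k)\<^sup>2))" for n
    proof -
      have "(\<Prod>k=1..n. 1 - t\<^sup>2 / (real k)\<^sup>2) \<le> (\<Prod>k=1..n. exp (- t\<^sup>2 / (real k)\<^sup>2))"
      proof (intro prod_mono conjI)
        fix k assume "k \<in> {1..n}"
        then have "t \<le> real k" using t by auto
        then have "t\<^sup>2 \<le> (real k)\<^sup>2" using t by (intro power_mono) auto
        then show "0 \<le> 1 - t\<^sup>2 / (real k)\<^sup>2" using \<open>k \<in> _\<close> by (simp add: field_simps)
        show "1 - t\<^sup>2 / (real k)\<^sup>2 \<le> exp (- t\<^sup>2 / (real k)\<^sup>2)"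
          using exp_ge_add_one_self[of "- t\<^sup>2 / (real k)\<^sup>2"] by simp
      qed
      also have "\<dots> = exp (\<Sum>k=1..n. - t\<^sup>2 / (real k)\<^sup>2)" by (simp add: exp_sum)
      also have "(\<Sum>k=1..n. - t\<^sup>2 / (real k)\<^sup>2) = (\<Sum>k<n. - t\<^sup>2 / (1 + real k)\<^sup>2)"
        by (rule sum.reindex_bij_witness[of _ Suc "\<lambda>k. k - 1"]) (auto simp: of_nat_diff)
      also have "\<dots> = - t\<^sup>2 * (\<Sum>k<n. 1 / (1 + real k)\<^sup>2)" by (simp add: sum_distrib_left)
      finally show ?thesis .
    qed
    then show "\<exists>N. \<forall>n\<ge>N. (\<Prod>k=1..n. 1 - t\<^sup>2 / (of_nat k)\<^sup>2) \<le> exp (- t\<^sup>2 * (\<Sum>k<n. 1 / (1 + real k)\<^sup>2))"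
      by blast
  qed
  also have "\<dots> \<le> exp (- pi * t\<^sup>2 / 2)"
  proof -
    have "3 * pi \<le> pi * pi" using pi_gt3 by (intro mult_right_mono) auto
    then have "t\<^sup>2 * (pi / 2) \<le> t\<^sup>2 * (pi\<^sup>2 / 6)"
      by (intro mult_left_mono) (auto simp: power2_eq_square)
    then show ?thesis by (simp add: algebra_simps)
  qed
  finally show ?thesis .
qed

text \<open>For \<open>pi * t \<ge> 4\<close> the bound 1 on the sine suffices. Otherwise the zero
  at t = 1 gives \<open>pi * (t - 1)\<close>, which is below \<open>pi * t / 4\<close> since
  \<open>3 * pi * t / 4 < 3 < pi\<close>.\<close>

lemma abs_sinc_le_quarter:
  fixes t :: real
  assumes t: "1 \<le> t"
  shows "\<bar>sin (pi * t) / (pi * t)\<bar> \<le> 1 / 4"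
proof -
  have "\<bar>sin (pi * t)\<bar> \<le> pi * t / 4"
  proof (cases "4 \<le> pi * t")
    case True
    then show ?thesis using abs_sin_le_one[of "pi * t"] by linarith
  next
    case False
    have "sin (pi * t) = - sin (pi * (t - 1))" by (simp add: algebra_simps)
    then have "\<bar>sin (pi * t)\<bar> \<le> pi * (t - 1)" using t abs_sin_x_le_abs_x[of "pi * (t - 1)"] by simp
    then show ?thesis using False pi_gt3 by (simp add: algebra_simps)
  qed
  then show ?thesis using t by (simp add: abs_mult field_simps)
qed

section \<open>Mass of the squared sinc function\<close>

text \<open>The library's \<open>sinc\<close> has value 1 at 0, where \<open>sin x / x\<close> is 0 by convention.\<close>
definition sinc_sq :: "real \<Rightarrow> real" where
  "sinc_sq t = (sinc (pi * t))\<^sup>2"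

lemma sinc_sq_eq: "t \<noteq> 0 \<Longrightarrow> sinc_sq t = (sin (pi * t))\<^sup>2 / (pi\<^sup>2 * t\<^sup>2)"
  by (simp add: sinc_sq_def power_divide power_mult_distrib)

lemma continuous_on_sinc_sq: "continuous_on S sinc_sq"
  unfolding sinc_sq_def by (intro continuous_on_power continuous_on_sinc continuous_intros)

text \<open>Integration by parts of \<open>sin^2 (pi t) / (pi t)^2\<close> yields this primitive;
  writing the boundary term with \<open>sinc\<close> makes it continuous at 0, with value 0.\<close>

definition sinc_sq_primitive :: "real \<Rightarrow> real" where
  "sinc_sq_primitive t = Si (2 * pi * t) / pi - sinc (pi * t) * sin (pi * t) / pi"

lemma DERIV_sinc_sq_primitive:
  assumes t: "0 < t"
  shows "(sinc_sq_primitive has_real_derivative sinc_sq t) (at t)"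
proof -
  have "((\<lambda>t. Si (2 * pi * t) / pi - (sin (pi * t))\<^sup>2 / (pi\<^sup>2 * t)) has_real_derivative sinc_sq t) (at t)"
  proof -
    have "(Si has_real_derivative sin (2 * pi * t) / (2 * pi * t)) (at (2 * pi * t))"
      using DERIV_Si[of "2 * pi * t"] t by simp
    then have "((\<lambda>t. Si (2 * pi * t)) has_real_derivative (sin (2 * pi * t) / (2 * pi * t)) * (2 * pi)) (at t)"
      by (rule DERIV_chain2) (auto intro!: derivative_eq_intros)
    then have "((\<lambda>t. Si (2 * pi * t) / pi - (sin (pi * t))\<^sup>2 / (pi\<^sup>2 * t)) has_real_derivative
      (sin (2 * pi * t) / (2 * pi * t)) * (2 * pi) / pi
        - (2 * sin (pi * t) * (cos (pi * t) * pi) * (pi\<^sup>2 * t) - (sin (pi * t))\<^sup>2 * pi\<^sup>2) / (pi\<^sup>2 * t)\<^sup>2) (at t)"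
      using t by (auto intro!: derivative_eq_intros simp: power2_eq_square)
    moreover have "(sin (2 * pi * t) / (2 * pi * t)) * (2 * pi) / pi
        - (2 * sin (pi * t) * (cos (pi * t) * pi) * (pi\<^sup>2 * t) - (sin (pi * t))\<^sup>2 * pi\<^sup>2) / (pi\<^sup>2 * t)\<^sup>2 = sinc_sq t"
      using t sin_double[of "pi * t"] by (simp add: sinc_sq_eq field_simps power2_eq_square)
    ultimately show ?thesis by simp
  qed
  then show ?thesis
  proof (rule DERIV_cong_ev[THEN iffD1, rotated -1])
    show "\<forall>\<^sub>F x in nhds t. Si (2 * pi * x) / pi - (sin (pi * x))\<^sup>2 / (pi\<^sup>2 * x) = sinc_sq_primitive x"
      using eventually_nhds_in_open[of "{0<..}" t] t
      by (auto elim!: eventually_mono simp: sinc_sq_primitive_def power2_eq_square)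
  qed auto
qed

lemma has_integral_sinc_sq:
  assumes A: "0 \<le> A"
  shows "(sinc_sq has_integral sinc_sq_primitive A) {0..A}"
proof -
  \<comment> \<open>The derivative is available for positive t only, so the endpoint 0 is handled by
    continuity.\<close>
  have "(sinc_sq has_integral (sinc_sq_primitive A - sinc_sq_primitive 0)) {0..A}"
  proof (rule fundamental_theorem_of_calculus_interior[OF A])
    have "continuous_on UNIV Si" by (intro continuous_at_imp_continuous_on ballI isCont_Si)
    then have "continuous_on {0..A} (\<lambda>t. Si (2 * pi * t))"
      by (rule continuous_on_compose2) (auto intro!: continuous_on_mult continuous_on_const continuous_on_id)
    moreover have "continuous_on {0..A} (\<lambda>t. sinc (pi * t))"
      by (rule continuous_on_sinc) (intro continuous_on_mult continuous_on_const continuous_on_id)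
    moreover have "continuous_on {0..A} (\<lambda>t. sin (pi * t))" by (intro continuous_intros)
    ultimately show "continuous_on {0..A} sinc_sq_primitive"
      unfolding sinc_sq_primitive_def
      by (intro continuous_on_diff continuous_on_divide continuous_on_mult continuous_on_const) simp_all
    show "(sinc_sq_primitive has_vector_derivative sinc_sq t) (at t)" if "t \<in> {0<..<A}" for t
      using DERIV_sinc_sq_primitive[of t] that by (simp add: has_real_derivative_iff_has_vector_derivative)
  qed
  moreover have "sinc_sq_primitive 0 = 0"
    by (simp add: sinc_sq_primitive_def Si_def zero_ereal_def[symmetric])
  ultimately show ?thesis by simp
qed

text \<open>The primitive minus the correction term is nondecreasing and tends to 1/2, because
  \<open>Si\<close> tends to pi/2; hence it never exceeds 1/2.\<close>

lemma sinc_sq_primitive_le: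
  assumes A: "0 < A"
  shows "sinc_sq_primitive A \<le> 1 / 2 + (- 1 / (2 * A) - sin (2 * pi * A) / (4 * pi * A\<^sup>2) + 1 / (4 * pi * A\<^sup>2)) / pi\<^sup>2"
proof -
  \<comment> \<open>One integration by parts of the oscillating part of \<open>sin\<^sup>2 (\<pi>t) / t\<^sup>2\<close>, with the remainder bounded absolutely.\<close>
  define H where "H t = - 1 / (2 * t) - sin (2 * pi * t) / (4 * pi * t\<^sup>2) + 1 / (4 * pi * t\<^sup>2)" for t :: real
  define Q where "Q t = sinc_sq_primitive t - H t / pi\<^sup>2" for t
  have DH: "(H has_real_derivative (sin (pi * t))\<^sup>2 / t\<^sup>2 + (sin (2 * pi * t) - 1) / (2 * pi * t^3)) (at t)"
    if "0 < t" for t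
  proof -
    have "(H has_real_derivative 1 / (2 * t\<^sup>2) - (cos (2 * pi * t) * (2 * pi) * (4 * pi * t\<^sup>2) - sin (2 * pi * t) * (8 * pi * t)) / (4 * pi * t\<^sup>2)\<^sup>2
        - (8 * pi * t) / (4 * pi * t\<^sup>2)\<^sup>2) (at t)"
      unfolding H_def using that
      by (auto intro!: derivative_eq_intros simp: power2_eq_square field_simps)
    moreover have "1 / (2 * t\<^sup>2) - (cos (2 * pi * t) * (2 * pi) * (4 * pi * t\<^sup>2) - sin (2 * pi * t) * (8 * pi * t)) / (4 * pi * t\<^sup>2)\<^sup>2
        - (8 * pi * t) / (4 * pi * t\<^sup>2)\<^sup>2 = (1 - cos (2 * pi * t)) / (2 * t\<^sup>2) + (sin (2 * pi * t) - 1) / (2 * pi * t^3)"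
      using that by (simp add: field_simps power2_eq_square power3_eq_cube)
    moreover have "1 - cos (2 * pi * t) = 2 * (sin (pi * t))\<^sup>2"
      using cos_double_sin[of "pi * t"] by (simp add: mult.assoc)
    ultimately show ?thesis by simp
  qed
  \<comment> \<open>The summand \<open>1 / (4 * pi * t^2)\<close> of \<open>H\<close> turns the
    remainder \<open>- sin (2 * pi * t)\<close> into \<open>1 - sin (2 * pi * t)\<close>, so the
    derivative of \<open>Q\<close> is nonnegative.\<close>
  have mono: "Q A \<le> Q B" if "A \<le> B" for B
  proof (rule DERIV_nonneg_imp_nondecreasing[OF that])
    fix t assume "A \<le> t" "t \<le> B"
    then have t: "0 < t" using A by simp
    have "(Q has_real_derivative sinc_sq t - ((sin (pi * t))\<^sup>2 / t\<^sup>2 + (sin (2 * pi * t) - 1) / (2 * pi * t^3)) / pi\<^sup>2) (at t)"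
      unfolding Q_def by (intro DERIV_diff DERIV_sinc_sq_primitive DERIV_cdivide DH t)
    moreover have "sinc_sq t - ((sin (pi * t))\<^sup>2 / t\<^sup>2 + (sin (2 * pi * t) - 1) / (2 * pi * t^3)) / pi\<^sup>2
        = (1 - sin (2 * pi * t)) / (2 * pi * t^3) / pi\<^sup>2"
      using t by (simp add: sinc_sq_eq field_simps)
    moreover have "0 \<le> (1 - sin (2 * pi * t)) / (2 * pi * t^3) / pi\<^sup>2"
      using t by (intro divide_nonneg_nonneg) auto
    ultimately show "\<exists>y. (Q has_real_derivative y) (at t) \<and> 0 \<le> y" by metis
  qed
  have lim: "(Q \<longlongrightarrow> 1 / 2) at_top"
  proof -
    have "((\<lambda>t. Si (2 * pi * t)) \<longlongrightarrow> pi / 2) at_top"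
      by (rule filterlim_compose[OF Si_at_top]) real_asymp
    then have 1: "((\<lambda>t. Si (2 * pi * t) / pi) \<longlongrightarrow> (pi / 2) / pi) at_top" by (intro tendsto_intros) auto
    have 2: "((\<lambda>t. (sin (pi * t))\<^sup>2 / (pi\<^sup>2 * t)) \<longlongrightarrow> 0) at_top"
    proof (rule Lim_null_comparison)
      show "\<forall>\<^sub>F t in at_top. norm ((sin (pi * t))\<^sup>2 / (pi\<^sup>2 * t)) \<le> 1 / (pi\<^sup>2 * t)"
        using eventually_gt_at_top[of 0]
        by eventually_elim (auto intro!: divide_right_mono simp: power_le_one abs_square_le_1)
    qed real_asymp
    have 3: "((\<lambda>t. sin (2 * pi * t) / (4 * pi * t\<^sup>2)) \<longlongrightarrow> 0) at_top"
    proof (rule Lim_null_comparison)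
      show "\<forall>\<^sub>F t in at_top. norm (sin (2 * pi * t) / (4 * pi * t\<^sup>2)) \<le> 1 / (4 * pi * t\<^sup>2)"
        using eventually_gt_at_top[of 0]
        by eventually_elim (auto intro!: divide_right_mono simp: abs_mult)
    qed real_asymp
    have 4: "((\<lambda>t. - 1 / (2 * t)) \<longlongrightarrow> (0::real)) at_top" "((\<lambda>t. 1 / (4 * pi * t\<^sup>2)) \<longlongrightarrow> 0) at_top"
      by real_asymp+
    have "((\<lambda>t. Si (2 * pi * t) / pi - (sin (pi * t))\<^sup>2 / (pi\<^sup>2 * t) - H t / pi\<^sup>2) \<longlongrightarrow> (pi / 2) / pi - 0 - (0 - 0 + 0) / pi\<^sup>2) at_top"
      unfolding H_def by (intro tendsto_diff tendsto_add tendsto_divide tendsto_const 1 2 3 4) auto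
    then have "((\<lambda>t. Si (2 * pi * t) / pi - (sin (pi * t))\<^sup>2 / (pi\<^sup>2 * t) - H t / pi\<^sup>2) \<longlongrightarrow> 1 / 2) at_top" by simp
    then show ?thesis
      by (rule Lim_transform_eventually)
         (use eventually_gt_at_top[of 0] in \<open>eventually_elim, auto simp: Q_def sinc_sq_primitive_def power2_eq_square\<close>)
  qed
  have "Q A \<le> 1 / 2"
    using mono by (intro tendsto_lowerbound[OF lim]) (auto intro: eventually_mono[OF eventually_ge_at_top[of A]])
  then show ?thesis unfolding Q_def H_def by linarith
qed

section \<open>Gaussian mass and tail, and the comparison of excess integrals\<close>

definition gauss :: "real \<Rightarrow> real" where
  "gauss t = exp (- pi * t\<^sup>2)"

lemma continuous_on_gauss: "continuous_on S gauss"
  unfolding gauss_def by (intro continuous_intros)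

text \<open>The half-line Gaussian integral \<open>sqrt pi / 2\<close>, rescaled by
  \<open>sqrt pi\<close>.\<close>

lemma gauss_integral_at_top: "((\<lambda>s. integral {0..s} gauss) \<longlongrightarrow> 1 / 2) at_top"
proof -
  have "has_bochner_integral lborel (\<lambda>x. indicator {0..} (0 + sqrt pi * x) *\<^sub>R exp (- (0 + sqrt pi * x)\<^sup>2)) ((sqrt pi / 2) /\<^sub>R \<bar>sqrt pi\<bar>)"
    using gaussian_moment_0 by (subst lborel_has_bochner_integral_real_affine_iff[symmetric]) auto
  also have "(\<lambda>x. indicator {0..} (0 + sqrt pi * x) *\<^sub>R exp (- (0 + sqrt pi * x)\<^sup>2)) = (\<lambda>x. indicator {0..} x *\<^sub>R gauss x)"
    by (auto simp: fun_eq_iff gauss_def indicator_def power_mult_distrib zero_le_mult_iff not_le)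
  finally have hb: "has_bochner_integral lborel (\<lambda>x. indicator {0..} x *\<^sub>R gauss x) (1 / 2)" by simp
  have "((\<lambda>s. \<integral>x. indicator {..s} x *\<^sub>R (indicator {0..} x *\<^sub>R gauss x) \<partial>lborel) \<longlongrightarrow> (\<integral>x. indicator {0..} x *\<^sub>R gauss x \<partial>lborel)) at_top"
    using hb by (intro tendsto_integral_at_top) (auto simp: has_bochner_integral_iff)
  moreover have "(\<integral>x. indicator {..s} x *\<^sub>R (indicator {0..} x *\<^sub>R gauss x) \<partial>lborel) = integral {0..s} gauss" for s
  proof -
    have "(\<integral>x. indicator {..s} x *\<^sub>R (indicator {0..} x *\<^sub>R gauss x) \<partial>lborel) = (LINT x:{0..s}|lborel. gauss x)"
      unfolding set_lebesgue_integral_def by (intro Bochner_Integration.integral_cong) (auto simp: indicator_def)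
    also have "\<dots> = integral {0..s} gauss"
      by (intro set_borel_integral_eq_integral borel_integrable_atLeastAtMost' continuous_on_gauss)
    finally show ?thesis .
  qed
  ultimately show ?thesis using has_bochner_integral_integral_eq[OF hb] by (simp only:)
qed

text \<open>Mills-ratio bound for the tail: \<open>- gauss t / (2 * pi * t)\<close> has derivative
  \<open>gauss t * (1 + 1 / (2 * pi * t^2))\<close>, which dominates \<open>gauss t\<close>.
  Subtract the tail from the total mass 1/2.\<close>

lemma gauss_integral_ge:
  assumes s: "0 < s"
  shows "1 / 2 - gauss s / (2 * pi * s) \<le> integral {0..s} gauss"
proof -
  have int: "gauss integrable_on {a..b}" for a b
    by (intro integrable_continuous_interval continuous_on_gauss)
  have "integral {0..B} gauss \<le> integral {0..s} gauss + gauss s / (2 * pi * s)" if B: "s \<le> B" for B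
  proof -
    have FTC: "((\<lambda>t. gauss t * (1 + 1 / (2 * pi * t\<^sup>2))) has_integral (- gauss B / (2 * pi * B) - - gauss s / (2 * pi * s))) {s..B}"
    proof (rule fundamental_theorem_of_calculus[OF B])
      fix t assume t: "t \<in> {s..B}"
      then have "((\<lambda>t. - gauss t / (2 * pi * t)) has_real_derivative gauss t * (1 + 1 / (2 * pi * t\<^sup>2))) (at t within {s..B})"
        unfolding gauss_def using s by (auto intro!: derivative_eq_intros simp: field_simps power2_eq_square)
      then show "((\<lambda>t. - gauss t / (2 * pi * t)) has_vector_derivative gauss t * (1 + 1 / (2 * pi * t\<^sup>2))) (at t within {s..B})"
        by (simp add: has_real_derivative_iff_has_vector_derivative)
    qed
    have "integral {s..B} gauss \<le> - gauss B / (2 * pi * B) - - gauss s / (2 * pi * s)"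
    proof (rule has_integral_le[OF integrable_integral[OF int] FTC])
      show "gauss t \<le> gauss t * (1 + 1 / (2 * pi * t\<^sup>2))" for t
        by (auto simp: gauss_def intro: mult_left_mono)
    qed
    also have "\<dots> \<le> gauss s / (2 * pi * s)" using s B by (simp add: gauss_def)
    finally show ?thesis
      using Henstock_Kurzweil_Integration.integral_combine[of 0 s B gauss] int s B by simp
  qed
  then have "1 / 2 \<le> integral {0..s} gauss + gauss s / (2 * pi * s)"
    by (intro tendsto_upperbound[OF gauss_integral_at_top]) (auto intro: eventually_mono[OF eventually_ge_at_top[of s]])
  then show ?thesis by simp
qed

text \<open>Replace the exponential by its tangent at \<open>ln 4\<close>, where it has value and
  slope 4. What remains is a quadratic inequality in s, settled by
  \<open>s \<ge> 0.92\<close>.\<close>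

lemma exp_gauss_lower_bound:
  assumes s: "0 < s" and four: "4 \<le> exp (pi * s\<^sup>2 / 2)"
  shows "pi * s + 1 / (2 * s) + 1 / 4 \<le> exp (pi * s\<^sup>2 / 2)"
proof -
  have pi: "3.1415 \<le> pi" "pi \<le> 3.1416" using pi_approx by auto
  have ln4: "ln (4::real) = 2 * ln 2" using ln_realpow[of 2 2] by simp
  have "ln 4 \<le> pi * s\<^sup>2 / 2" using ln_mono[OF four] by simp
  then have "8 / 3 \<le> pi * s\<^sup>2" using ln4 ln2_ge_two_thirds by linarith
  also have "\<dots> \<le> 3.1416 * s\<^sup>2" using pi by (intro mult_right_mono) auto
  \<comment> \<open>Numerically \<open>3.1416 * 0.92^2\<close> is about 2.659, just below
    8/3.\<close>
  finally have "0.92\<^sup>2 \<le> s\<^sup>2" by (simp add: power2_eq_square)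
  then have s92: "0.92 \<le> s" using s by (intro power2_le_imp_le[of "0.92" s]) auto
  have "4 * (1 + pi * s\<^sup>2 / 2 - 25 / 18) \<le> 4 * (1 + (pi * s\<^sup>2 / 2 - ln 4))"
    using ln4 ln2_le_25_over_36 by simp
  also have "\<dots> \<le> 4 * exp (pi * s\<^sup>2 / 2 - ln 4)" by (intro mult_left_mono exp_ge_add_one_self) simp
  also have "\<dots> = exp (pi * s\<^sup>2 / 2)" by (simp add: exp_diff)
  finally have "4 * (1 + pi * s\<^sup>2 / 2 - 25 / 18) \<le> exp (pi * s\<^sup>2 / 2)" .
  moreover have "1 / (2 * s) \<le> 1 / (2 * 0.92)" using s92 by (intro divide_left_mono) auto
  \<comment> \<open>With \<open>4 * (1 - 25 / 18) = - 14 / 9\<close>, it remains to see that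
    \<open>pi * s * (2 * s - 1)\<close>, at least 2.42, exceeds
    \<open>14 / 9 + 1 / 4 + 1 / (2 * s)\<close>, at most 2.35.\<close>
  moreover have "3.1415 * (0.92 * (2 * 0.92 - 1)) \<le> pi * (s * (2 * s - 1))"
    using pi s92 by (intro mult_mono) auto
  ultimately show ?thesis by (simp add: power2_eq_square algebra_simps)
qed

text \<open>At levels from 1/16 on the comparison is pointwise and S = T works. At lower levels S is
  the point where \<open>gauss\<close> meets c, so the Gaussian excess is captured in full and the
  two masses below the level are compared.\<close>

lemma excess_sinc_sq_le_gauss:
  assumes c: "0 < c" and T: "0 \<le> T"
  shows "\<exists>S\<ge>0. integral {0..T} (\<lambda>t. max 0 (sinc_sq t - c)) \<le> integral {0..S} (\<lambda>t. max 0 (gauss t - c))"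
proof -
  have intu: "(\<lambda>t. max 0 (sinc_sq t - c)) integrable_on {a..b}"
    and intv: "(\<lambda>t. max 0 (gauss t - c)) integrable_on {a..b}" for a b
    by (intro integrable_continuous_interval continuous_intros continuous_on_sinc_sq continuous_on_gauss)+
  show ?thesis
  proof (cases "1 / 16 \<le> c")
    case True
    have "max 0 (sinc_sq t - c) \<le> max 0 (gauss t - c)" if t: "t \<in> {0..T}" for t
    proof -
      consider "t = 0" | "0 < t" "t \<le> 1" | "1 \<le> t" using t by fastforce
      then show ?thesis
      proof cases
        case 1
        then show ?thesis by (simp add: sinc_sq_def gauss_def)
      next
        case 2
        have "0 \<le> sin (pi * t)" using 2 by (intro sin_ge_zero) (auto simp: mult_le_cancel_left1)
        then have "(sin (pi * t) / (pi * t))\<^sup>2 \<le> (exp (- pi * t\<^sup>2 / 2))\<^sup>2"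
          using sinc_le_gaussian[OF 2] 2 by (intro power_mono) auto
        also have "\<dots> = gauss t" by (simp add: gauss_def flip: exp_double)
        finally show ?thesis using 2 by (simp add: sinc_sq_def)
      next
        case 3
        have "(sin (pi * t) / (pi * t))\<^sup>2 \<le> (1 / 4)\<^sup>2"
          using abs_sinc_le_quarter[OF 3] by (simp only: abs_le_square_iff[symmetric])
        also have "\<dots> \<le> c" using True by (simp add: power2_eq_square)
        finally have "sinc_sq t \<le> c" using 3 by (simp add: sinc_sq_def)
        then show ?thesis by simp
      qed
    qed
    then show ?thesis using T by (intro exI[of _ T] conjI integral_le intu intv)
  next
    case False
    \<comment> \<open>A is where the envelope \<open>1 / (pi^2 * t^2)\<close> of
      \<open>sinc_sq\<close> meets c, and s is where \<open>gauss\<close> does. Consequently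
      \<open>exp (pi * s^2 / 2) = 1 / sqrt c = pi * A\<close>, and \<open>c < 1/16\<close> makes
      this at least 4.\<close>
    define A where "A = 1 / (pi * sqrt c)"
    define s where "s = sqrt (ln (1 / c) / pi)"
    have A: "0 < A" and cA: "c = 1 / (pi\<^sup>2 * A\<^sup>2)"
      using c by (auto simp: A_def power_mult_distrib power_divide)
    have lnc: "0 < ln (1 / c)" using c False by (intro ln_gt_zero) (simp add: field_simps)
    then have s: "0 < s" and s2: "pi * s\<^sup>2 = ln (1 / c)" by (auto simp: s_def)
    have gs: "gauss s = c" using c by (simp add: gauss_def s2 ln_div)
    have "(exp (pi * s\<^sup>2 / 2))\<^sup>2 = exp (pi * s\<^sup>2)" by (simp flip: exp_double)
    also have "\<dots> = (pi * A)\<^sup>2" using c A by (simp add: s2 cA power_mult_distrib)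
    finally have expA: "exp (pi * s\<^sup>2 / 2) = pi * A" using A by (simp add: power2_eq_iff_nonneg)
    have "sqrt c \<le> 1 / 4" using False c by (intro real_le_lsqrt) (auto simp: power2_eq_square)
    then have "4 \<le> pi * A" using c by (simp add: A_def field_simps)
    then have key: "pi * s + 1 / (2 * s) + 1 / 4 \<le> pi * A"
      using exp_gauss_lower_bound[OF s] by (simp add: expA)

    have "integral {0..T} (\<lambda>t. max 0 (sinc_sq t - c)) \<le> integral {0..max T A} (\<lambda>t. max 0 (sinc_sq t - c))"
      by (intro integral_subset_le intu) auto
    also have "\<dots> = integral {0..A} (\<lambda>t. max 0 (sinc_sq t - c)) + integral {A..max T A} (\<lambda>t. max 0 (sinc_sq t - c))"
      using A by (intro Henstock_Kurzweil_Integration.integral_combine[symmetric] intu) auto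
    also have "integral {A..max T A} (\<lambda>t. max 0 (sinc_sq t - c)) = integral {A..max T A} (\<lambda>t. 0)"
    proof (rule integral_cong)
      fix t assume "t \<in> {A..max T A}"
      then have t: "A \<le> t" "0 < t" using A by auto
      have "sinc_sq t \<le> 1 / (pi\<^sup>2 * t\<^sup>2)"
        using t by (auto simp: sinc_sq_eq abs_square_le_1 intro!: divide_right_mono)
      also have "\<dots> \<le> c" unfolding cA using A t by (intro divide_left_mono mult_left_mono power_mono) auto
      finally show "max 0 (sinc_sq t - c) = 0" by simp
    qed
    \<comment> \<open>On [0, A] both c and \<open>sinc_sq t\<close> are at least
      \<open>c * sin^2 (pi t)\<close>, so subtracting this function instead of the smaller of the
      two only enlarges the integral.\<close>
    also have "integral {0..A} (\<lambda>t. max 0 (sinc_sq t - c)) + integral {A..max T A} (\<lambda>t. 0)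
        \<le> sinc_sq_primitive A - c * (A / 2 - sin (2 * pi * A) / (4 * pi))"
    proof -
      have "((\<lambda>t. (sin (pi * t))\<^sup>2) has_integral ((A / 2 - sin (2 * pi * A) / (4 * pi)) - (0 / 2 - sin (2 * pi * 0) / (4 * pi)))) {0..A}"
      proof (rule fundamental_theorem_of_calculus)
        fix t assume "t \<in> {0..A}"
        have "((\<lambda>t. t / 2 - sin (2 * pi * t) / (4 * pi)) has_real_derivative (1 - cos (2 * pi * t)) / 2) (at t within {0..A})"
          by (auto intro!: derivative_eq_intros simp: field_simps)
        moreover have "(1 - cos (2 * pi * t)) / 2 = (sin (pi * t))\<^sup>2"
          using cos_double_sin[of "pi * t"] by (simp add: mult.assoc)
        ultimately show "((\<lambda>t. t / 2 - sin (2 * pi * t) / (4 * pi)) has_vector_derivative (sin (pi * t))\<^sup>2) (at t within {0..A})"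
          by (simp add: has_real_derivative_iff_has_vector_derivative)
      qed (use A in auto)
      then have "((\<lambda>t. (sin (pi * t))\<^sup>2) has_integral (A / 2 - sin (2 * pi * A) / (4 * pi))) {0..A}" by simp
      then have *: "((\<lambda>t. sinc_sq t - c * (sin (pi * t))\<^sup>2) has_integral sinc_sq_primitive A - c * (A / 2 - sin (2 * pi * A) / (4 * pi))) {0..A}"
        using A by (intro has_integral_diff has_integral_sinc_sq has_integral_mult_right) auto
      have "integral {0..A} (\<lambda>t. max 0 (sinc_sq t - c)) \<le> sinc_sq_primitive A - c * (A / 2 - sin (2 * pi * A) / (4 * pi))"
      proof (rule has_integral_le[OF integrable_integral[OF intu] *])
        fix t assume t: "t \<in> {0..A}"
        have "c * (sin (pi * t))\<^sup>2 \<le> sinc_sq t"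
        proof (cases "t = 0")
          case False
          then have "(sin (pi * t))\<^sup>2 / (pi\<^sup>2 * A\<^sup>2) \<le> (sin (pi * t))\<^sup>2 / (pi\<^sup>2 * t\<^sup>2)"
            using t by (intro divide_left_mono mult_left_mono power_mono) auto
          then show ?thesis using False by (simp add: sinc_sq_eq cA)
        qed (simp add: sinc_sq_def)
        moreover have "c * (sin (pi * t))\<^sup>2 \<le> c" using c by (simp add: mult_le_cancel_left1 abs_square_le_1)
        ultimately show "max 0 (sinc_sq t - c) \<le> sinc_sq t - c * (sin (pi * t))\<^sup>2" by simp
      qed
      then show ?thesis by simp
    qed
    also have "\<dots> \<le> 1 / 2 + (- c * A / 2 - c * sin (2 * pi * A) / (4 * pi) + c / (4 * pi)) - c * (A / 2 - sin (2 * pi * A) / (4 * pi))"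
    proof -
      have "(- 1 / (2 * A) - sin (2 * pi * A) / (4 * pi * A\<^sup>2) + 1 / (4 * pi * A\<^sup>2)) / pi\<^sup>2
          = - c * A / 2 - c * sin (2 * pi * A) / (4 * pi) + c / (4 * pi)"
        using A unfolding cA by (simp add: field_simps power2_eq_square)
      then show ?thesis using sinc_sq_primitive_le[OF A] by simp
    qed
    \<comment> \<open>The terms in \<open>sin (2 * pi * A)\<close> cancel: the boundary term from
      the tail of \<open>sinc_sq\<close> matches the one from integrating
      \<open>c * sin^2 (pi t)\<close>.\<close>
    also have "\<dots> = 1 / 2 - c * (A - 1 / (4 * pi))" by (simp add: algebra_simps)
    also have "\<dots> \<le> 1 / 2 - c * (s + 1 / (2 * pi * s))"
    proof -
      have "(pi * s + 1 / (2 * s)) / pi \<le> (pi * A - 1 / 4) / pi" using key by (intro divide_right_mono) auto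
      then have "s + 1 / (2 * pi * s) \<le> A - 1 / (4 * pi)" using s by (simp add: field_simps)
      then have "c * (s + 1 / (2 * pi * s)) \<le> c * (A - 1 / (4 * pi))" using c by (intro mult_left_mono) auto
      then show ?thesis by simp
    qed
    \<comment> \<open>Since \<open>gauss s = c\<close>, the Gaussian tail bound is exactly
      \<open>c / (2 * pi * s)\<close>.\<close>
    also have "\<dots> \<le> integral {0..s} gauss - c * s"
      using gauss_integral_ge[OF s] by (simp add: gs algebra_simps)
    also have "\<dots> = integral {0..s} (\<lambda>t. gauss t - c)"
      using s by (subst Henstock_Kurzweil_Integration.integral_diff)
        (auto intro!: integrable_continuous_interval continuous_on_gauss)
    also have "\<dots> \<le> integral {0..s} (\<lambda>t. max 0 (gauss t - c))"
      by (intro integral_le intv integrable_continuous_interval continuous_intros continuous_on_gauss) auto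
    finally show ?thesis using s by (intro exI[of _ s]) auto
  qed
qed

theorem mainTheorem1:
  fixes N :: "(real \<Rightarrow> real) \<Rightarrow> ennreal"
  assumes "ri_space N" and "exact_p_convex 2 N"
  shows "N (\<lambda>t. sin (pi * t) / (pi * t)) \<le> N (\<lambda>t. exp (- pi * t\<^sup>2 / 2))"
proof -
  interpret two_convex_ri_space N using assms by unfold_locales
  \<comment> \<open>The square root of \<open>sinc_sq\<close> is the absolute value of the sinc
    function, so the two sides agree in modulus for positive t, and the lattice property discards
    the sign.\<close>
  have "N (\<lambda>t. sin (pi * t) / (pi * t)) \<le> N (\<lambda>t. sqrt (sinc_sq t))"
  proof (rule N_mono)
    show "meas0 (\<lambda>t. sqrt (sinc_sq t))"
      by (intro meas0_sqrt meas0_borel borel_measurable_continuous_onI continuous_on_sinc_sq)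
    show "meas0 (\<lambda>t. sin (pi * t) / (pi * t))" by (intro meas0_borel) measurable
  qed (simp add: sinc_sq_def)
  also have "\<dots> \<le> N (\<lambda>t. sqrt (gauss t))"
  proof (rule N_sqrt_le_of_excess_le[where C = 1])
    fix t :: real assume t: "0 < t"
    have pi: "1 \<le> pi" using pi_gt3 by simp
    have "sinc_sq t \<le> 1 / (pi\<^sup>2 * t\<^sup>2)"
      using t by (auto simp: sinc_sq_eq abs_square_le_1 intro!: divide_right_mono)
    also have "\<dots> \<le> 1 / (1 * t\<^sup>2)"
      using t pi by (intro divide_left_mono mult_right_mono one_le_power) auto
    finally show "sinc_sq t \<le> 1 / t\<^sup>2" by simp
    have "1 * t\<^sup>2 \<le> pi * t\<^sup>2" using pi by (intro mult_right_mono) auto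
    also have "\<dots> \<le> exp (pi * t\<^sup>2)" using exp_ge_add_one_self[of "pi * t\<^sup>2"] by linarith
    finally show "gauss t \<le> 1 / t\<^sup>2" using t by (simp add: gauss_def exp_minus field_simps)
  next
    show "0 \<le> sinc_sq t" "0 < gauss t" for t by (simp_all add: sinc_sq_def gauss_def)
    show "gauss t \<le> gauss s" if "0 \<le> s" "s \<le> t" for s t
      using that by (simp add: gauss_def power_mono)
  qed (intro continuous_on_sinc_sq continuous_on_gauss excess_sinc_sq_le_gauss; assumption)+
  also have "(\<lambda>t. sqrt (gauss t)) = (\<lambda>t. exp (- pi * t\<^sup>2 / 2))"
  proof
    fix t
    have "gauss t = (exp (- pi * t\<^sup>2 / 2))\<^sup>2" by (simp add: gauss_def flip: exp_double)
    then show "sqrt (gauss t) = exp (- pi * t\<^sup>2 / 2)" by simp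
  qed
  finally show ?thesis .
qed

end
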